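(* Let $I$ be either $G_m$ or $[-\pi,\pi]$, let $1\le p<\infty$, let $f\in L_p(I)$, and let the family $\{\Phi_n\}_{n=1}^\infty\subset L_\infty(I)$ form an approximate identity. Then $$\|\Phi_n * f-f\|_p\to 0\quad\text{as } n\to\infty .$$
   Context: $\mathbb{N}_+$ is the set of positive integers and $\mathbb{N}=\mathbb{N}_+\cup\{0\}$. Let $m=(m_0,m_1,\dots)$ be a bounded sequence of integers, $m_k\ge 2$. $G_m$ is the complete direct product of the additive groups $Z_{m_k}=\{0,1,\dots,m_k-1\}$ of integers modulo $m_k$, with the product of the discrete topologies and coordinatewise group operations; its elements are sequences $x=(x_0,x_1,\dots)$ with $x_k\in Z_{m_k}$. $\mu$ is the normalized Haar measure on $G_m$ (the product of the uniform probability measures on $Z_{m_k}$). For $N\in\mathbb{N}_+$, $I_N(0)=\{y\in G_m: y_0=\dots=y_{N-1}=0\}$. On $[-\pi,\pi]$, $\mu$ is normalized Lebesgue measure $d\mu=dx/(2\pi)$, and functions are extended $2\pi$-periodically. The notation is unified as follows: $I$ denotes $G_m$ or $[-\pi,\pi]$, and for $N\in\mathbb{N}_+$, $I_N$ denotes $I_N(0)$ if $I=G_m$, and $[-1/2^N,1/2^N]$ if $I=[-\pi,\pi]$. The convolution is $(\Phi * f)(x)=\int_I \Phi(t)f(x-t)\,d\mu(t)$, and $\|\cdot\|_p$ is the norm of $L_p(I)=L_p(I,\mu)$. A family $\{\Phi_n\}_{n=1}^\infty\subset L_\infty(I)$ forms an approximate identity if (A1) $\int_I\Phi_n\,d\mu=1$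 for every $n\in\mathbb{N}_+$; (A2) $\sup_{n\in\mathbb{N}_+}\int_I|\Phi_n|\,d\mu<\infty$; (A3) for every $N\in\mathbb{N}_+$, $\int_{I\setminus I_N}|\Phi_n|\,d\mu\to 0$ as $n\to\infty$. *)

theory Defs
  imports "HOL-Probability.Probability" "HOL-Library.Real_Mod"
begin

section \<open>Lebesgue spaces, convolution and approximate identities\<close>

text \<open>
  Functions are complex-valued. The domain \<open>I\<close> enters through its measure \<open>M\<close>, its sets
  \<open>I\<^sub>N\<close> (the parameter \<open>nbh\<close>) and its subtraction (the parameter \<open>sub\<close>).
\<close>

definition Lp_space :: "'a measure \<Rightarrow> real \<Rightarrow> ('a \<Rightarrow> complex) set" where
  "Lp_space M p = {f \<in> borel_measurable M. integrable M (\<lambda>x. norm (f x) powr p)}"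

text \<open>The norm is real-valued; it is meaningful only on members of \<open>Lp_space M p\<close>.\<close>

definition Lp_norm :: "'a measure \<Rightarrow> real \<Rightarrow> ('a \<Rightarrow> complex) \<Rightarrow> real" where
  "Lp_norm M p f = (LINT x|M. norm (f x) powr p) powr (1 / p)"

definition Linf_space :: "'a measure \<Rightarrow> ('a \<Rightarrow> complex) set" where
  "Linf_space M = {f \<in> borel_measurable M. \<exists>C. AE x in M. norm (f x) \<le> C}"

definition convol ::
  "'a measure \<Rightarrow> ('a \<Rightarrow> 'a \<Rightarrow> 'a) \<Rightarrow> ('a \<Rightarrow> complex) \<Rightarrow> ('a \<Rightarrow> complex) \<Rightarrow> 'a \<Rightarrow> complex" where
  "convol M sub \<Phi> f x = (LINT t|M. \<Phi> t * f (sub x t))"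

text \<open>Families are indexed by the positive integers; the value at index 0 is ignored.\<close>

definition approximate_identity ::
  "'a measure \<Rightarrow> (nat \<Rightarrow> 'a set) \<Rightarrow> (nat \<Rightarrow> 'a \<Rightarrow> complex) \<Rightarrow> bool" where
  "approximate_identity M nbh \<Phi> \<longleftrightarrow>
     (\<forall>n\<ge>1. \<Phi> n \<in> Linf_space M) \<and>
     (\<forall>n\<ge>1. (LINT x|M. \<Phi> n x) = 1) \<and>
     bdd_above ((\<lambda>n. LINT x|M. norm (\<Phi> n x)) ` {1..}) \<and>
     (\<forall>N\<ge>1. (\<lambda>n. LINT x:(space M - nbh N)|M. norm (\<Phi> n x)) \<longlonglongrightarrow> 0)"


section \<open>The group \<open>G\<^sub>m\<close>\<close>

text \<open>
  The underlying space is \<open>\<Pi>\<^sub>E k\<in>UNIV. {0..<m k}\<close>. As the factors are finite and discrete and there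
  are countably many of them, the product sigma-algebra is the Borel sigma-algebra of the product
  topology.
\<close>

definition vilenkin_measure :: "(nat \<Rightarrow> int) \<Rightarrow> (nat \<Rightarrow> int) measure" where
  "vilenkin_measure m = (\<Pi>\<^sub>M k\<in>UNIV. uniform_count_measure {0..<m k})"

definition vilenkin_minus :: "(nat \<Rightarrow> int) \<Rightarrow> (nat \<Rightarrow> int) \<Rightarrow> (nat \<Rightarrow> int) \<Rightarrow> (nat \<Rightarrow> int)" where
  "vilenkin_minus m x y = (\<lambda>k. (x k - y k) mod m k)"

definition vilenkin_nbh :: "(nat \<Rightarrow> int) \<Rightarrow> nat \<Rightarrow> (nat \<Rightarrow> int) set" where
  "vilenkin_nbh m N = {y \<in> space (vilenkin_measure m). \<forall>k<N. y k = 0}"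


section \<open>The interval \<open>[-\<pi>, \<pi>]\<close>\<close>

definition trig_measure :: "real measure" where
  "trig_measure = density (lebesgue_on {-pi..pi}) (\<lambda>x. ennreal (1 / (2 * pi)))"

text \<open>
  \<open>trig_minus x t\<close> is the representative of \<open>x - t\<close> modulo \<open>2\<pi>\<close> in \<open>[-\<pi>, \<pi>)\<close>, so that
  \<open>f (trig_minus x t)\<close> is the value at \<open>x - t\<close> of the \<open>2\<pi>\<close>-periodic extension of \<open>f\<close>. At odd
  multiples of \<open>\<pi>\<close>, a null set, the extension takes the value \<open>f (- \<pi>)\<close>.
\<close>

definition trig_minus :: "real \<Rightarrow> real \<Rightarrow> real" where
  "trig_minus x t = (x - t + pi) rmod (2 * pi) - pi"

definition trig_nbh :: "nat \<Rightarrow> real set" where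
  "trig_nbh N = {- (1 / 2 ^ N)..1 / 2 ^ N}"

end

theory Submission
  imports Defs
begin

text \<open>
  As \<open>\<integral>\<Phi>\<^sub>n = 1\<close>, the difference \<open>(\<Phi>\<^sub>n * f - f)(x)\<close> is the integral of \<open>\<Phi>\<^sub>n(t) (f(x - t) - f(x))\<close>
  over \<open>t\<close>. Jensen's inequality for the weight \<open>|\<Phi>\<^sub>n|\<close> of mass \<open>A\<^sub>n\<close> followed by Tonelli's theorem
  gives
  \<open>\<parallel>\<Phi>\<^sub>n * f - f\<parallel>\<^sub>p\<^sup>p \<le> A\<^sub>n\<^sup>p\<^sup>-\<^sup>1 \<integral> |\<Phi>\<^sub>n(t)| \<omega>(t) d\<mu>(t)\<close> with \<open>\<omega>(t) = \<parallel>f(\<cdot> - t) - f\<parallel>\<^sub>p\<^sup>p\<close>.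
  The function \<open>\<omega>\<close> is bounded, and it is small on \<open>I\<^sub>N\<close> for large \<open>N\<close> by continuity of translations in
  \<open>L\<^sub>p\<close>. The latter extends from indicators of a generating \<open>\<pi>\<close>-system (cylinder sets, respectively
  intervals) to all measurable sets by Dynkin's argument, and then to simple functions and their
  \<open>L\<^sub>p\<close> limits. Both domains satisfy the axioms of one abstract locale, the interval with its Borel
  sets only: subtraction need not be jointly measurable for the product of the Lebesgue
  sigma-algebras, so that functions are first replaced by Borel representatives.
\<close>

section \<open>Power integrals\<close>

text \<open>The p-th power of the norm. The estimates are carried out for it because it is a plain
  integral; \<open>Lp_norm_tendsto_0\<close> takes the root at the end.\<close>

definition Lp_pow :: "'a measure \<Rightarrow> real \<Rightarrow> ('a \<Rightarrow> complex) \<Rightarrow> real" where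
  "Lp_pow M p f = (LINT x|M. norm (f x) powr p)"

lemma Lp_pow_nonneg: "0 \<le> Lp_pow M p f"
  unfolding Lp_pow_def by (rule integral_nonneg_AE) simp

text \<open>A sum is at most twice its larger term, and the p-th power of that term is one of the
  two summands. The resulting quasi-triangle inequality for \<open>Lp_pow\<close> suffices for
  limits that are 0, where constant factors are harmless.\<close>

lemma powr_add_le:
  fixes a b p :: real
  assumes "0 \<le> a" "0 \<le> b" "0 \<le> p"
  shows "(a + b) powr p \<le> 2 powr p * (a powr p + b powr p)"
proof -
  have "(a + b) powr p \<le> (2 * max a b) powr p"
    using assms by (intro powr_mono2) auto
  also have "\<dots> = 2 powr p * (max a b) powr p"
    using assms by (simp add: powr_mult)
  also have "\<dots> \<le> 2 powr p * (a powr p + b powr p)"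
    by (intro mult_left_mono) (auto simp: max_def)
  finally show ?thesis .
qed

lemma norm_add_powr_le:
  fixes a b :: complex
  assumes "0 \<le> p"
  shows "norm (a + b) powr p \<le> 2 powr p * (norm a powr p + norm b powr p)"
  using powr_mono2[OF assms norm_ge_zero norm_triangle_ineq[of a b]]
    powr_add_le[of "norm a" "norm b" p] assms by simp

lemma Lp_space_borel [measurable_dest]: "f \<in> Lp_space M p \<Longrightarrow> f \<in> borel_measurable M"
  by (simp add: Lp_space_def)

lemma Lp_space_integrable: "f \<in> Lp_space M p \<Longrightarrow> integrable M (\<lambda>x. norm (f x) powr p)"
  by (simp add: Lp_space_def)

lemma Lp_space_bound:
  assumes [measurable]: "f \<in> borel_measurable M" and "integrable M g"
    and "AE x in M. norm (f x) powr p \<le> g x"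
  shows "f \<in> Lp_space M p"
proof -
  have "integrable M (\<lambda>x. norm (f x) powr p)"
    using assms(3) by (intro Bochner_Integration.integrable_bound[OF assms(2)]) auto
  then show ?thesis
    by (simp add: Lp_space_def)
qed

lemma Lp_space_add:
  assumes f: "f \<in> Lp_space M p" and g: "g \<in> Lp_space M p" and p: "0 \<le> p"
  shows "(\<lambda>x. f x + g x) \<in> Lp_space M p"
    and "Lp_pow M p (\<lambda>x. f x + g x) \<le> 2 powr p * (Lp_pow M p f + Lp_pow M p g)"
proof -
  have [measurable]: "f \<in> borel_measurable M" "g \<in> borel_measurable M"
    using f g by (auto simp: Lp_space_def)
  have int: "integrable M (\<lambda>x. 2 powr p * (norm (f x) powr p + norm (g x) powr p))"
    using f g by (intro integrable_mult_right Bochner_Integration.integrable_add) (auto simp: Lp_space_def)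
  show *: "(\<lambda>x. f x + g x) \<in> Lp_space M p"
    by (rule Lp_space_bound[OF _ int]) (auto intro!: norm_add_powr_le p)
  have "Lp_pow M p (\<lambda>x. f x + g x) \<le> (LINT x|M. 2 powr p * (norm (f x) powr p + norm (g x) powr p))"
    unfolding Lp_pow_def
    by (intro integral_mono Lp_space_integrable * int norm_add_powr_le p)
  also have "\<dots> = 2 powr p * (Lp_pow M p f + Lp_pow M p g)"
    using Lp_space_integrable[OF f] Lp_space_integrable[OF g] by (simp add: Lp_pow_def)
  finally show "Lp_pow M p (\<lambda>x. f x + g x) \<le> 2 powr p * (Lp_pow M p f + Lp_pow M p g)" .
qed

lemma Lp_space_cmult:
  assumes f: "f \<in> Lp_space M p"
  shows "(\<lambda>x. c * f x) \<in> Lp_space M p"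
    and "Lp_pow M p (\<lambda>x. c * f x) = norm c powr p * Lp_pow M p f"
  using f by (auto simp: Lp_space_def Lp_pow_def norm_mult powr_mult)

lemma Lp_space_diff:
  assumes f: "f \<in> Lp_space M p" and g: "g \<in> Lp_space M p" and p: "0 \<le> p"
  shows "(\<lambda>x. f x - g x) \<in> Lp_space M p"
    and "Lp_pow M p (\<lambda>x. f x - g x) \<le> 2 powr p * (Lp_pow M p f + Lp_pow M p g)"
  using Lp_space_add[OF f Lp_space_cmult(1)[OF g, of "-1"] p] Lp_space_cmult(2)[OF g, of "-1"]
  by simp_all

text \<open>Dominated convergence with majorant |g|^p. Positivity of p makes the power continuous at
  base 0.\<close>

lemma Lp_pow_tendsto_0:
  assumes [measurable]: "\<And>i. s i \<in> borel_measurable M" "f \<in> borel_measurable M"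
    and int: "integrable M (\<lambda>x. norm (g x) powr p)" and p: "0 < p"
    and lim: "\<And>x. x \<in> space M \<Longrightarrow> (\<lambda>i. s i x) \<longlonglongrightarrow> f x"
    and bound: "\<And>i x. x \<in> space M \<Longrightarrow> norm (s i x - f x) \<le> norm (g x)"
  shows "(\<lambda>i. Lp_pow M p (\<lambda>x. s i x - f x)) \<longlonglongrightarrow> 0"
proof -
  have "(\<lambda>i. LINT x|M. norm (s i x - f x) powr p) \<longlonglongrightarrow> (LINT x|M. 0)"
  proof (rule integral_dominated_convergence[OF _ _ int])
    show "AE x in M. (\<lambda>i. norm (s i x - f x) powr p) \<longlonglongrightarrow> 0"
    proof (rule AE_I2)
      fix x assume "x \<in> space M"
      then have "(\<lambda>i. norm (s i x - f x)) \<longlonglongrightarrow> 0"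
        using lim by (simp add: LIM_zero_iff tendsto_norm_zero_iff)
      then show "(\<lambda>i. norm (s i x - f x) powr p) \<longlonglongrightarrow> 0"
        using tendsto_powr'[of _ 0 sequentially "\<lambda>_. p" p] p by simp
    qed
    show "AE x in M. norm (norm (s i x - f x) powr p) \<le> norm (g x) powr p" for i
      using bound p by (intro AE_I2) (auto intro!: powr_mono2)
  qed auto
  then show ?thesis
    by (simp add: Lp_pow_def)
qed

lemma Lp_norm_tendsto_0:
  assumes "(\<lambda>n. Lp_pow M p (f n)) \<longlonglongrightarrow> 0" "0 < p"
  shows "(\<lambda>n. Lp_norm M p (f n)) \<longlonglongrightarrow> 0"
  using tendsto_powr'[OF assms(1) tendsto_const[of "1 / p"]] assms(2) Lp_pow_nonneg[of M p]
  by (simp add: Lp_norm_def Lp_pow_def)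

section \<open>Jensen's inequality for powers with respect to a weight\<close>

lemma powr_above_tangent:
  fixes p s g :: real
  assumes p: "1 \<le> p" and s: "0 \<le> s" and g: "0 \<le> g"
  shows "s powr p + p * s powr (p - 1) * (g - s) \<le> g powr p"
proof (cases "s = 0 \<or> g = 0")
  case True
  \<comment> \<open>For s = 0 the convention \<open>0 powr x = 0\<close> makes the left side 0, also
    when p = 1. For g = 0 it equals (1 - p) s^p.\<close>
  show ?thesis
  proof (cases "s = 0")
    case False
    then have "g = 0" using True by simp
    have "s powr p = s * s powr (p - 1)"
      using s False by (simp add: powr_mult_base)
    then have "s powr p + p * s powr (p - 1) * (g - s) = (1 - p) * s powr p"
      using \<open>g = 0\<close> by (simp add: algebra_simps)
    also have "\<dots> \<le> 0"
      using p by (intro mult_nonpos_nonneg) auto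
    finally show ?thesis
      using \<open>g = 0\<close> by simp
  qed simp
next
  case False
  then have pos: "0 < s" "0 < g" using s g by auto
  \<comment> \<open>For positive arguments: a convex function on the positive half-line lies above
    its tangent at s.\<close>
  have "g powr p - s powr p \<ge> (p * s powr (p - 1)) * (g - s)"
  proof (rule convex_on_imp_above_tangent[OF powr_convex[OF p]])
    show "((\<lambda>x. x powr p) has_real_derivative p * s powr (p - 1)) (at s within {0<..})"
      using pos by (auto intro!: derivative_eq_intros)
  qed (use pos in \<open>auto simp: interior_open\<close>)
  then show ?thesis by simp
qed

text \<open>Integrate the tangent inequality at the weighted mean s of g against w. The linear term
  integrates to 0, which leaves W s^p on the left; multiplication by W^(p-1) turns this into (s
  W)^p.\<close>

lemma weighted_power_mean:
  fixes w g :: "'a \<Rightarrow> real"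
  assumes p: "1 \<le> p"
    and w: "integrable M w" and wg: "integrable M (\<lambda>x. w x * g x)"
    and wgp: "integrable M (\<lambda>x. w x * g x powr p)"
    and nonneg: "\<And>x. 0 \<le> w x" "\<And>x. 0 \<le> g x"
    and pos: "0 < (LINT x|M. w x)"
  shows "(LINT x|M. w x * g x) powr p \<le> (LINT x|M. w x) powr (p - 1) * (LINT x|M. w x * g x powr p)"
proof -
  define W where "W = (LINT x|M. w x)"
  define s where "s = (LINT x|M. w x * g x) / W"
  have W: "0 < W" using pos by (simp add: W_def)
  have s: "0 \<le> s"
    unfolding s_def using nonneg W by (auto intro!: divide_nonneg_nonneg integral_nonneg_AE)
  have sW: "(LINT x|M. w x * g x) = s * W" using W by (simp add: s_def)
  let ?c = "p * s powr (p - 1)"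
  have eq: "w x * (s powr p + ?c * (g x - s)) = (s powr p - ?c * s) * w x + ?c * (w x * g x)" for x
    by (simp add: algebra_simps)
  have "(LINT x|M. w x * (s powr p + ?c * (g x - s))) \<le> (LINT x|M. w x * g x powr p)"
  proof (rule integral_mono[OF _ wgp])
    show "integrable M (\<lambda>x. w x * (s powr p + ?c * (g x - s)))"
      unfolding eq using w wg by (intro Bochner_Integration.integrable_add integrable_mult_right) auto
  qed (intro mult_left_mono powr_above_tangent p s nonneg)
  also have "(LINT x|M. w x * (s powr p + ?c * (g x - s))) = W * s powr p"
    unfolding eq using w wg by (simp add: sW flip: W_def) (simp add: algebra_simps)
  finally have *: "W * s powr p \<le> (LINT x|M. w x * g x powr p)" .
  have "(s * W) powr p = W powr (p - 1) * (W * s powr p)"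
    using W s by (simp add: powr_mult powr_diff)
  also have "\<dots> \<le> W powr (p - 1) * (LINT x|M. w x * g x powr p)"
    by (intro mult_left_mono *) simp
  finally show ?thesis
    by (simp add: sW W_def)
qed

section \<open>Translations\<close>

text \<open>\<open>G\<close> is a generating pi-system on which continuity of translations is tested
  in measure. Of the two \<open>distr\<close> axioms, the one in x preserves the power integrals of
  translates, and the one in t makes t \<mapsto> f(x - t) as integrable as f for each fixed x. Joint
  measurability of \<open>sub\<close> serves the change of the order of integration.\<close>

locale translation_space = prob_space M
  for M :: "'a measure" and sub :: "'a \<Rightarrow> 'a \<Rightarrow> 'a" and nbh :: "nat \<Rightarrow> 'a set" and G :: "'a set set" +
  assumes sub_measurable: "(\<lambda>(x, t). sub x t) \<in> M \<Otimes>\<^sub>M M \<rightarrow>\<^sub>M M"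
    and distr_sub_left: "x \<in> space M \<Longrightarrow> distr M M (\<lambda>t. sub x t) = M"
    and distr_sub_right: "t \<in> space M \<Longrightarrow> distr M M (\<lambda>x. sub x t) = M"
    and nbh_sets: "nbh N \<in> sets M"
    and nbh_antimono: "antimono nbh"
    and sets_generated: "sets M = sigma_sets (space M) G"
    and G_Int_stable: "Int_stable G"
    and G_space: "G \<subseteq> Pow (space M)"
    and G_continuous: "A \<in> G \<Longrightarrow> 0 < e \<Longrightarrow>
      \<exists>N\<ge>1. \<forall>t\<in>nbh N. measure M {x \<in> space M. (sub x t \<in> A) \<noteq> (x \<in> A)} < e"
begin

lemma sub_measurable' [measurable (raw)]:
  assumes "f \<in> N \<rightarrow>\<^sub>M M" "g \<in> N \<rightarrow>\<^sub>M M"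
  shows "(\<lambda>x. sub (f x) (g x)) \<in> N \<rightarrow>\<^sub>M M"
  using measurable_compose[OF measurable_Pair[OF assms] sub_measurable] by simp

lemma nbh_space: "t \<in> nbh N \<Longrightarrow> t \<in> space M"
  using sets.sets_into_space[OF nbh_sets] by auto

lemma sub_space: "x \<in> space M \<Longrightarrow> t \<in> space M \<Longrightarrow> sub x t \<in> space M"
  using measurable_space[OF sub_measurable, of "(x, t)"] by (simp add: space_pair_measure)

lemma
  fixes h :: "'a \<Rightarrow> 'b::{banach, second_countable_topology}"
  assumes t: "t \<in> space M" and h [measurable]: "h \<in> borel_measurable M"
  shows integrable_sub_right: "integrable M (\<lambda>x. h (sub x t)) \<longleftrightarrow> integrable M h"
    and integral_sub_right: "(LINT x|M. h (sub x t)) = (LINT x|M. h x)"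
proof -
  note [measurable] = t
  show "integrable M (\<lambda>x. h (sub x t)) \<longleftrightarrow> integrable M h"
    using integrable_distr_eq[of "\<lambda>x. sub x t" M M h] by (simp add: distr_sub_right t)
  show "(LINT x|M. h (sub x t)) = (LINT x|M. h x)"
    using integral_distr[of "\<lambda>x. sub x t" M M h] by (simp add: distr_sub_right t)
qed

lemma integrable_sub_left:
  fixes h :: "'a \<Rightarrow> 'b::{banach, second_countable_topology}"
  assumes x: "x \<in> space M" and h [measurable]: "h \<in> borel_measurable M"
  shows "integrable M (\<lambda>t. h (sub x t)) \<longleftrightarrow> integrable M h"
proof -
  note [measurable] = x
  show ?thesis
    using integrable_distr_eq[of "\<lambda>t. sub x t" M M h] by (simp add: distr_sub_left x)
qed

lemma Lp_translate:
  assumes f: "f \<in> Lp_space M p" and t: "t \<in> space M"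
  shows "(\<lambda>x. f (sub x t)) \<in> Lp_space M p"
    and "Lp_pow M p (\<lambda>x. f (sub x t)) = Lp_pow M p f"
proof -
  note [measurable] = t Lp_space_borel[OF f]
  show "(\<lambda>x. f (sub x t)) \<in> Lp_space M p"
    using integrable_sub_right[OF t, of "\<lambda>x. norm (f x) powr p"] f by (simp add: Lp_space_def)
  show "Lp_pow M p (\<lambda>x. f (sub x t)) = Lp_pow M p f"
    using integral_sub_right[OF t, of "\<lambda>x. norm (f x) powr p"] by (simp add: Lp_pow_def)
qed

section \<open>Continuity of translations in L_p\<close>

definition near :: "'a filter" where
  "near = (INF N\<in>{1..}. principal (nbh N))"

text \<open>The sets \<open>nbh N\<close> decrease, so their principal filters are directed and a
  single N decides. Smallness on some I_N thereby becomes a limit along \<open>near\<close>; the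
  index starts at 1 as in (A3).\<close>

lemma eventually_near: "eventually P near \<longleftrightarrow> (\<exists>N\<ge>1. \<forall>t\<in>nbh N. P t)"
proof -
  have "eventually P near \<longleftrightarrow> (\<exists>N\<in>{1..}. eventually P (principal (nbh N)))"
    unfolding near_def
  proof (rule eventually_INF_base)
    fix a b :: nat assume "a \<in> {1..}" "b \<in> {1..}"
    then show "\<exists>x\<in>{1..}. principal (nbh x) \<le> inf (principal (nbh a)) (principal (nbh b))"
      using antimonoD[OF nbh_antimono, of a "max a b"] antimonoD[OF nbh_antimono, of b "max a b"]
      by (intro bexI[of _ "max a b"]) auto
  qed auto
  then show ?thesis
    by (auto simp: eventually_principal)
qed

lemma near_space: "eventually (\<lambda>t. t \<in> space M) near"
  unfolding eventually_near using nbh_space by blast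

text \<open>Membership in L_p is included because the Bochner integral of a non-integrable function
  is 0, which would make the limit hold for no reason.\<close>

definition translation_continuous :: "real \<Rightarrow> ('a \<Rightarrow> complex) \<Rightarrow> bool" where
  "translation_continuous p f \<longleftrightarrow>
     f \<in> Lp_space M p \<and> ((\<lambda>t. Lp_pow M p (\<lambda>x. f (sub x t) - f x)) \<longlongrightarrow> 0) near"

text \<open>Complements of indicators and canonical forms of simple functions agree with the
  intended function on the space only.\<close>

lemma translation_continuous_cong:
  assumes "\<And>x. x \<in> space M \<Longrightarrow> f x = g x"
  shows "translation_continuous p f \<longleftrightarrow> translation_continuous p g"
proof -
  have 1: "f \<in> Lp_space M p \<longleftrightarrow> g \<in> Lp_space M p"
    unfolding Lp_space_def using assms
    by (auto cong: measurable_cong intro: Bochner_Integration.integrable_cong[THEN iffD1, rotated -1])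
  have "((\<lambda>t. Lp_pow M p (\<lambda>x. f (sub x t) - f x)) \<longlongrightarrow> 0) near \<longleftrightarrow>
      ((\<lambda>t. Lp_pow M p (\<lambda>x. g (sub x t) - g x)) \<longlongrightarrow> 0) near"
  proof (rule tendsto_cong, rule eventually_mono[OF near_space])
    fix t assume "t \<in> space M"
    then show "Lp_pow M p (\<lambda>x. f (sub x t) - f x) = Lp_pow M p (\<lambda>x. g (sub x t) - g x)"
      unfolding Lp_pow_def using assms
      by (intro Bochner_Integration.integral_cong) (auto simp: sub_space)
  qed
  with 1 show ?thesis
    by (simp add: translation_continuous_def)
qed

lemma translation_continuous_const: "translation_continuous p (\<lambda>x. c)"
  by (simp add: translation_continuous_def Lp_space_def Lp_pow_def)

lemma translation_continuous_cmult:
  assumes "translation_continuous p f"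
  shows "translation_continuous p (\<lambda>x. c * f x)"
proof -
  have "Lp_pow M p (\<lambda>x. c * f (sub x t) - c * f x) =
      norm c powr p * Lp_pow M p (\<lambda>x. f (sub x t) - f x)" for t
    by (simp add: Lp_pow_def norm_mult powr_mult flip: right_diff_distrib)
  then show ?thesis
    using assms tendsto_mult_right_zero[of _ near "norm c powr p"]
    by (simp add: translation_continuous_def Lp_space_cmult)
qed

lemma translation_continuous_add:
  assumes p: "0 \<le> p" and f: "translation_continuous p f" and g: "translation_continuous p g"
  shows "translation_continuous p (\<lambda>x. f x + g x)"
proof -
  have fL: "f \<in> Lp_space M p" and gL: "g \<in> Lp_space M p"
    using f g by (auto simp: translation_continuous_def)
  have "((\<lambda>t. Lp_pow M p (\<lambda>x. (f (sub x t) + g (sub x t)) - (f x + g x))) \<longlongrightarrow> 0) near"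
  proof (rule Lim_null_comparison)
    show "((\<lambda>t. 2 powr p * (Lp_pow M p (\<lambda>x. f (sub x t) - f x) + Lp_pow M p (\<lambda>x. g (sub x t) - g x)))
        \<longlongrightarrow> 0) near"
      using f g unfolding translation_continuous_def
      by (intro tendsto_mult_right_zero tendsto_add_zero) auto
    show "\<forall>\<^sub>F t in near. norm (Lp_pow M p (\<lambda>x. (f (sub x t) + g (sub x t)) - (f x + g x))) \<le>
      2 powr p * (Lp_pow M p (\<lambda>x. f (sub x t) - f x) + Lp_pow M p (\<lambda>x. g (sub x t) - g x))"
      using near_space
    proof eventually_elim
      case (elim t)
      have "(\<lambda>x. (f (sub x t) + g (sub x t)) - (f x + g x)) =
          (\<lambda>x. (f (sub x t) - f x) + (g (sub x t) - g x))"
        by (simp add: algebra_simps)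
      then show ?case
        using Lp_space_add(2)[OF Lp_space_diff(1)[OF Lp_translate(1)[OF fL elim] fL p]
            Lp_space_diff(1)[OF Lp_translate(1)[OF gL elim] gL p] p]
        by (simp add: Lp_pow_nonneg)
    qed
  qed
  then show ?thesis
    using Lp_space_add(1)[OF fL gL p] by (simp add: translation_continuous_def)
qed

lemma translation_continuous_sum:
  assumes "0 \<le> p" "\<And>i. i \<in> I \<Longrightarrow> translation_continuous p (f i)"
  shows "translation_continuous p (\<lambda>x. \<Sum>i\<in>I. f i x)"
  using assms(2)
  by (induction I rule: infinite_finite_induct)
    (auto intro!: translation_continuous_const translation_continuous_add assms(1))

text \<open>With d = s_i - f, the difference f(x - t) - f(x) is (d(x) - d(x - t)) + (s_i(x - t) -
  s_i(x)). Translation invariance makes the first bracket small for all t at once, so one good s_i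
  serves every t.\<close>

lemma translation_continuous_limit:
  assumes p: "0 \<le> p" and f: "f \<in> Lp_space M p"
    and s: "\<And>i::nat. translation_continuous p (s i)"
    and lim: "(\<lambda>i. Lp_pow M p (\<lambda>x. s i x - f x)) \<longlonglongrightarrow> 0"
  shows "translation_continuous p f"
proof -
  \<comment> \<open>If each of the three power integrals is at most q, two nested uses of the
    quasi-triangle inequality give the bound \<open>?C\<close> times q; hence the threshold e /
    \<open>?C\<close>.\<close>
  let ?C = "2 powr p * (2 powr p * 2 + 1)"
  have regroup: "a * (a * (q + q) + q) = q * (a * (a * 2 + 1))" for a q :: real
    by (simp add: algebra_simps)
  have cancel: "e / c * c = e" if "0 < c" for e c :: real
    using that by simp
  have "((\<lambda>t. Lp_pow M p (\<lambda>x. f (sub x t) - f x)) \<longlongrightarrow> 0) near"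
  proof (rule tendstoI)
    fix e :: real assume e: "0 < e"
    have C: "0 < ?C" by (intro mult_pos_pos add_nonneg_pos) auto
    have "eventually (\<lambda>i. Lp_pow M p (\<lambda>x. s i x - f x) < e / ?C) sequentially"
      using order_tendstoD(2)[OF lim, of "e / ?C"] e C by simp
    then obtain i where i: "Lp_pow M p (\<lambda>x. s i x - f x) < e / ?C"
      by (auto simp: eventually_sequentially)
    have sL: "s i \<in> Lp_space M p" and st: "((\<lambda>t. Lp_pow M p (\<lambda>x. s i (sub x t) - s i x)) \<longlongrightarrow> 0) near"
      using s[of i] by (auto simp: translation_continuous_def)
    have "eventually (\<lambda>t. Lp_pow M p (\<lambda>x. s i (sub x t) - s i x) < e / ?C) near"
      using order_tendstoD(2)[OF st, of "e / ?C"] e C by simp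
    with near_space show "eventually (\<lambda>t. dist (Lp_pow M p (\<lambda>x. f (sub x t) - f x)) 0 < e) near"
    proof eventually_elim
      case (elim t)
      let ?d = "\<lambda>x. s i x - f x"
      have dL: "?d \<in> Lp_space M p"
        by (rule Lp_space_diff(1)[OF sL f p])
      note dT = Lp_translate[OF dL elim(1)]
      note D = Lp_space_diff[OF dL dT(1) p]
      have "(\<lambda>x. f (sub x t) - f x) = (\<lambda>x. (?d x - ?d (sub x t)) + (s i (sub x t) - s i x))"
        by (simp add: algebra_simps)
      then have "Lp_pow M p (\<lambda>x. f (sub x t) - f x) \<le>
          2 powr p * (Lp_pow M p (\<lambda>x. ?d x - ?d (sub x t)) + Lp_pow M p (\<lambda>x. s i (sub x t) - s i x))"
        using Lp_space_add(2)[OF D(1) Lp_space_diff(1)[OF Lp_translate(1)[OF sL elim(1)] sL p] p] by simp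
      also have "\<dots> \<le> 2 powr p * (2 powr p * (Lp_pow M p ?d + Lp_pow M p ?d)
          + Lp_pow M p (\<lambda>x. s i (sub x t) - s i x))"
        using D(2) dT(2) by (intro mult_left_mono add_right_mono) auto
      also have "\<dots> < 2 powr p * (2 powr p * (e / ?C + e / ?C) + e / ?C)"
        using i elim(2) by (intro mult_strict_left_mono add_strict_mono) auto
      also have "\<dots> = e / ?C * ?C" by (rule regroup)
      also have "\<dots> = e" by (rule cancel[OF C])
      finally show ?case by (simp add: Lp_pow_nonneg)
    qed
  qed
  with f show ?thesis by (simp add: translation_continuous_def)
qed

lemma indicator_Lp_space:
  "A \<in> sets M \<Longrightarrow> (indicator A :: 'a \<Rightarrow> complex) \<in> Lp_space M p"
proof -
  assume [measurable]: "A \<in> sets M"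
  show ?thesis
    by (rule Lp_space_bound[where g = "\<lambda>_. 1"]) (auto simp: indicator_def)
qed

text \<open>The difference of the two indicators has modulus 1 where membership in A changes and 0
  elsewhere, so for every p its power integral is the measure in
  \<open>G_continuous\<close>.\<close>

lemma translation_continuous_indicator_generator:
  assumes A: "A \<in> G"
  shows "translation_continuous p (indicator A)"
proof -
  have AM [measurable]: "A \<in> sets M"
    using A sets_generated by auto
  have "((\<lambda>t. Lp_pow M p (\<lambda>x. indicator A (sub x t) - indicator A x)) \<longlongrightarrow> 0) near"
  proof (rule tendstoI)
    fix e :: real assume e: "0 < e"
    have "eventually (\<lambda>t. measure M {x \<in> space M. (sub x t \<in> A) \<noteq> (x \<in> A)} < e) near"
      using G_continuous[OF A e] by (simp add: eventually_near)
    with near_space show "eventually (\<lambda>t. dist (Lp_pow M p (\<lambda>x. indicator A (sub x t) - indicator A x)) 0 < e) near"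
    proof eventually_elim
      case (elim t)
      note [measurable] = elim(1)
      have "Lp_pow M p (\<lambda>x. indicator A (sub x t) - indicator A x) =
          (LINT x|M. indicator {x \<in> space M. (sub x t \<in> A) \<noteq> (x \<in> A)} x)"
        unfolding Lp_pow_def by (intro Bochner_Integration.integral_cong) (auto simp: indicator_def)
      also have "\<dots> = measure M {x \<in> space M. (sub x t \<in> A) \<noteq> (x \<in> A)}"
        by simp
      finally show ?case using elim(2) by simp
    qed
  qed
  with indicator_Lp_space[OF AM] show ?thesis
    by (simp add: translation_continuous_def)
qed

text \<open>The sets with this property form a Dynkin system: a complement is handled as 1 minus an
  indicator, and a countable disjoint union as the L_p limit of its finite partial unions, dominated
  by 1.\<close>

lemma translation_continuous_indicator:
  assumes p: "0 < p" and A: "A \<in> sets M"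
  shows "translation_continuous p (indicator A)"
proof -
  have "A \<in> sigma_sets (space M) G"
    using A sets_generated by simp
  with G_Int_stable G_space show ?thesis
  proof (induction rule: sigma_sets_induct_disjoint)
    case (basic A)
    then show ?case by (rule translation_continuous_indicator_generator)
  next
    case empty
    show ?case using translation_continuous_const[of p 0] by (simp add: indicator_def[abs_def])
  next
    case (compl A)
    have "translation_continuous p (\<lambda>x. 1 + (-1) * indicator A x)"
      using p by (intro translation_continuous_add translation_continuous_const
          translation_continuous_cmult compl) auto
    then show ?case
      by (rule translation_continuous_cong[THEN iffD1, rotated]) (auto simp: indicator_def)
  next
    case (union A)
    have AM [measurable]: "A i \<in> sets M" for i
      using union by (auto simp: sets_generated)
    let ?s = "\<lambda>i x. \<Sum>k<i. indicator (A k) x :: complex"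
    have s: "?s i x = indicator (\<Union>k<i. A k) x" for i x
      using union(1) by (subst indicator_UN_disjoint) (auto simp: disjoint_family_on_def)
    show ?case
    proof (rule translation_continuous_limit)
      show "translation_continuous p (?s i)" for i
        using p by (intro translation_continuous_sum union) auto
      show "(\<lambda>i. Lp_pow M p (\<lambda>x. ?s i x - indicator (\<Union>i. A i) x)) \<longlonglongrightarrow> 0"
        unfolding s
      proof (rule Lp_pow_tendsto_0[where g = "\<lambda>_. 1"])
        show "(\<lambda>i. indicator (\<Union>k<i. A k) x :: complex) \<longlonglongrightarrow> indicator (\<Union>i. A i) x" for x
          by (rule LIMSEQ_indicator_UN)
        show "norm (indicator (\<Union>k<i. A k) x - indicator (\<Union>i. A i) x :: complex) \<le> norm (1 :: complex)" for i x
          by (auto simp: indicator_def)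
      qed (use p in auto)
      show "indicator (\<Union>i. A i) \<in> Lp_space M p"
        by (intro indicator_Lp_space) measurable
    qed (use p in auto)
  qed
qed

lemma translation_continuous_simple_function:
  assumes p: "0 < p" and s: "simple_function M s"
  shows "translation_continuous p s"
proof -
  have "translation_continuous p (\<lambda>x. \<Sum>y\<in>s ` space M. y * indicator (s -` {y} \<inter> space M) x)"
    using p s by (intro translation_continuous_sum translation_continuous_cmult
        translation_continuous_indicator) (auto dest: simple_functionD)
  then show ?thesis
  proof (rule translation_continuous_cong[THEN iffD1, rotated])
    fix x assume x: "x \<in> space M"
    have "(\<Sum>y\<in>s ` space M. y * indicator (s -` {y} \<inter> space M) x) =
        (\<Sum>y\<in>s ` space M. if s x = y then y else 0)"
      using x by (intro sum.cong) (auto simp: indicator_def)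
    also have "\<dots> = s x"
      using simple_functionD(1)[OF s] x by simp
    finally show "(\<Sum>y\<in>s ` space M. y * indicator (s -` {y} \<inter> space M) x) = s x" .
  qed
qed

text \<open>Approximate pointwise by simple functions s_i with |s_i| \<le> 2|f|. Then |s_i - f|
  \<le> 3|f|, so dominated convergence makes the approximation one in L_p.\<close>

theorem translation_continuous_Lp:
  assumes p: "0 < p" and f: "f \<in> Lp_space M p"
  shows "translation_continuous p f"
proof -
  note [measurable] = Lp_space_borel[OF f]
  obtain s where s: "\<And>i. simple_function M (s i)"
    "\<And>x. x \<in> space M \<Longrightarrow> (\<lambda>i. s i x) \<longlonglongrightarrow> f x"
    "\<And>i x. x \<in> space M \<Longrightarrow> norm (s i x) \<le> 2 * norm (f x)"
    using borel_measurable_implies_sequence_metric[of f M 0] by simp metis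
  have [measurable]: "s i \<in> borel_measurable M" for i
    by (rule borel_measurable_simple_function[OF s(1)])
  have "(\<lambda>i. Lp_pow M p (\<lambda>x. s i x - f x)) \<longlonglongrightarrow> 0"
  proof (rule Lp_pow_tendsto_0[where g = "\<lambda>x. 3 * f x"])
    show "integrable M (\<lambda>x. norm (3 * f x) powr p)"
      using Lp_space_cmult(1)[OF f, of 3] by (simp add: Lp_space_def)
    show "norm (s i x - f x) \<le> norm (3 * f x)" if "x \<in> space M" for i x
      using norm_triangle_ineq4[of "s i x" "f x"] s(3)[OF that, of i] by (simp add: norm_mult)
  qed (use p s in auto)
  then show ?thesis
    using p by (intro translation_continuous_limit[OF _ f, where s = s]
        translation_continuous_simple_function s(1)) auto
qed

end

section \<open>Convolution with an approximate identity\<close>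

text \<open>The majorant is 1 + |f|^p: its first term covers the points with |f| \<le> 1, its second
  term the others.\<close>

lemma (in finite_measure) Lp_space_integrable_self:
  assumes p: "1 \<le> p" and f: "f \<in> Lp_space M p"
  shows "integrable M f"
proof (rule Bochner_Integration.integrable_bound)
  show "integrable M (\<lambda>x. 1 + norm (f x) powr p)"
    using f by (intro Bochner_Integration.integrable_add) (auto simp: Lp_space_def)
  show "AE x in M. norm (f x) \<le> norm (1 + norm (f x) powr p)"
  proof (rule AE_I2)
    fix x
    show "norm (f x) \<le> norm (1 + norm (f x) powr p)"
    proof (cases "norm (f x) \<le> 1")
      case True
      have "0 \<le> norm (f x) powr p" by simp
      with True show ?thesis by (simp only: real_norm_def)
    next
      case False
      then have "norm (f x) powr 1 \<le> norm (f x) powr p"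
        using p by (intro powr_mono) auto
      with False show ?thesis by simp
    qed
  qed
qed (use f in \<open>simp add: Lp_space_def\<close>)

text \<open>Stated for a general algebra because it is applied to the complex kernel as well as to
  its real modulus.\<close>

lemma integrable_Linf_mult:
  fixes g :: "'a \<Rightarrow> 'b::{real_normed_algebra, banach, second_countable_topology}" and w :: "'a \<Rightarrow> 'b"
  assumes w [measurable]: "w \<in> borel_measurable M" and C: "AE x in M. norm (w x) \<le> C"
    and g: "integrable M g"
  shows "integrable M (\<lambda>x. w x * g x)"
proof (rule Bochner_Integration.integrable_bound)
  show "integrable M (\<lambda>x. C * norm (g x))"
    using g by simp
  show "AE x in M. norm (w x * g x) \<le> norm (C * norm (g x))"
    using C
  proof eventually_elim
    case (elim x)
    then have "0 \<le> C" using norm_ge_zero order_trans by blast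
    have "norm (w x * g x) \<le> norm (w x) * norm (g x)"
      by (rule norm_mult_ineq)
    also have "\<dots> \<le> C * norm (g x)"
      using elim by (intro mult_right_mono) auto
    finally show ?case using \<open>0 \<le> C\<close> by simp
  qed
qed (use g in measurable)

section \<open>The estimate for one kernel and the convergence for a family\<close>

context translation_space
begin

text \<open>The integral of |\<phi>| \<omega> left by Jensen and Tonelli is split at I_N. Inside,
  \<omega> is at most e; outside, translation invariance bounds \<omega> by a constant multiple of
  the power integral of f, and the tail of |\<phi>| remains as a factor.\<close>

lemma convol_diff_bound:
  assumes p: "1 \<le> p" and f: "f \<in> Lp_space M p"
    and \<phi>: "\<phi> \<in> Linf_space M" "(LINT t|M. \<phi> t) = 1"
    and e: "\<And>t. t \<in> nbh N \<Longrightarrow> Lp_pow M p (\<lambda>x. f (sub x t) - f x) \<le> e"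
    and e_nonneg: "0 \<le> e"
  defines "A \<equiv> LINT t|M. norm (\<phi> t)"
  shows "(\<lambda>x. convol M sub \<phi> f x - f x) \<in> Lp_space M p"
    and "Lp_pow M p (\<lambda>x. convol M sub \<phi> f x - f x) \<le>
      A powr (p - 1) * (e * A + 2 powr p * (2 * Lp_pow M p f) * (LINT t:(space M - nbh N)|M. norm (\<phi> t)))"
proof -
  interpret pair_sigma_finite M M ..
  have [measurable]: "f \<in> borel_measurable M" "\<phi> \<in> borel_measurable M" "nbh N \<in> sets M"
    using f \<phi> nbh_sets by (auto simp: Lp_space_def Linf_space_def)
  obtain C where C: "AE t in M. norm (\<phi> t) \<le> C"
    using \<phi> by (auto simp: Linf_space_def)
  have p0: "0 \<le> p" using p by simp
  have \<phi>_int: "integrable M \<phi>"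
    using C by (intro integrable_const_bound[where B = C]) auto
  \<comment> \<open>The mass of |\<phi>| is at least the modulus of the integral of \<phi>, which is
    1. So the weight has positive mass, as Jensen's inequality demands.\<close>
  have A: "1 \<le> A"
    using integral_norm_bound[of M \<phi>] \<phi>(2) by (simp add: A_def)
  let ?D = "\<lambda>x t. f (sub x t) - f x"
  let ?F = "\<lambda>x t. norm (\<phi> t) * norm (?D x t) powr p"
  let ?\<omega> = "\<lambda>t. Lp_pow M p (\<lambda>x. ?D x t)"
  let ?K = "2 powr p * (2 * Lp_pow M p f)"
  have \<omega>_le: "?\<omega> t \<le> ?K" if "t \<in> space M" for t
    using Lp_space_diff(2)[OF Lp_translate(1)[OF f that] f p0] Lp_translate(2)[OF f that] by simp
  have D_int: "integrable M (\<lambda>x. norm (?D x t) powr p)" if "t \<in> space M" for t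
    by (rule Lp_space_integrable[OF Lp_space_diff(1)[OF Lp_translate(1)[OF f that] f p0]])
  have inner: "(LINT x|M. ?F x t) = norm (\<phi> t) * ?\<omega> t" for t
    by (simp add: Lp_pow_def)

  have \<phi>\<omega>_int: "integrable M (\<lambda>t. norm (\<phi> t) * ?\<omega> t)"
  proof (rule Bochner_Integration.integrable_bound)
    show "integrable M (\<lambda>t. norm (\<phi> t) * ?K)"
      using \<phi>_int by simp
    show "AE t in M. norm (norm (\<phi> t) * ?\<omega> t) \<le> norm (norm (\<phi> t) * ?K)"
      using \<omega>_le by (intro AE_I2) (auto simp: Lp_pow_nonneg abs_mult intro!: mult_left_mono)
    show "(\<lambda>t. norm (\<phi> t) * ?\<omega> t) \<in> borel_measurable M"
      unfolding Lp_pow_def by measurable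
  qed
  \<comment> \<open>Integrability on the product is checked with x as inner variable, where the
    inner integral is |\<phi>(t)| \<omega>(t); Fubini then gives the other order.\<close>
  have F_int: "integrable (M \<Otimes>\<^sub>M M) (\<lambda>(t, x). ?F x t)"
  proof (rule Fubini_integrable)
    show "integrable M (\<lambda>t. LINT x|M. norm (case (t, x) of (t, x) \<Rightarrow> ?F x t))"
      using \<phi>\<omega>_int by (simp add: inner abs_mult Lp_pow_def)
    show "AE t in M. integrable M (\<lambda>x. case (t, x) of (t, x) \<Rightarrow> ?F x t)"
      using D_int by (intro AE_I2) auto
  qed measurable
  have J_int: "integrable M (\<lambda>x. LINT t|M. ?F x t)"
    using integrable_snd[OF F_int] by simp
  have J: "(LINT x|M. LINT t|M. ?F x t) = (LINT t|M. norm (\<phi> t) * ?\<omega> t)"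
    using Fubini_integral[OF F_int] by (simp only: case_prod_conv inner)

  \<comment> \<open>This holds at every x of the space: \<phi> is essentially bounded and t
    \<mapsto> f(x - t) lies in L_p by invariance in t, so all the integrals exist.\<close>
  have pointwise: "norm (convol M sub \<phi> f x - f x) powr p \<le> A powr (p - 1) * (LINT t|M. ?F x t)"
    if x: "x \<in> space M" for x
  proof -
    note [measurable] = x
    have f1: "integrable M (\<lambda>t. f (sub x t))"
      using Lp_space_integrable_self[OF p f] integrable_sub_left[OF x, of f] by simp
    have "integrable M (\<lambda>t. norm (f (sub x t)) powr p)"
      using f integrable_sub_left[OF x, of "\<lambda>t. norm (f t) powr p"] by (simp add: Lp_space_def)
    then have "(\<lambda>t. f (sub x t)) \<in> Lp_space M p" "(\<lambda>t. f x) \<in> Lp_space M p"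
      by (auto simp: Lp_space_def)
    note D = Lp_space_diff(1)[OF this p0]
    have D1: "integrable M (?D x)"
      by (rule Lp_space_integrable_self[OF p D])
    have \<phi>f: "integrable M (\<lambda>t. \<phi> t * f (sub x t))"
      by (rule integrable_Linf_mult[OF _ C f1]) measurable
    have "convol M sub \<phi> f x - f x = (LINT t|M. \<phi> t * f (sub x t)) - (LINT t|M. \<phi> t * f x)"
      using \<phi> by (simp add: convol_def)
    also have "\<dots> = (LINT t|M. \<phi> t * ?D x t)"
      using \<phi>f \<phi>_int by (simp add: right_diff_distrib)
    finally have "norm (convol M sub \<phi> f x - f x) \<le> (LINT t|M. norm (\<phi> t) * norm (?D x t))"
      using integral_norm_bound[of M "\<lambda>t. \<phi> t * ?D x t"] by (simp add: norm_mult)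
    then have "norm (convol M sub \<phi> f x - f x) powr p \<le> (LINT t|M. norm (\<phi> t) * norm (?D x t)) powr p"
      using p by (intro powr_mono2) auto
    also have "\<dots> \<le> A powr (p - 1) * (LINT t|M. ?F x t)"
      unfolding A_def
    proof (rule weighted_power_mean[OF p])
      show "integrable M (\<lambda>t. norm (\<phi> t) * norm (?D x t))"
        using C D1 by (intro integrable_Linf_mult[where C = C]) auto
      show "integrable M (\<lambda>t. ?F x t)"
        using C Lp_space_integrable[OF D] by (intro integrable_Linf_mult[where C = C]) auto
    qed (use \<phi>_int A in \<open>auto simp: A_def\<close>)
    finally show ?thesis .
  qed
  show L: "(\<lambda>x. convol M sub \<phi> f x - f x) \<in> Lp_space M p"
  proof (rule Lp_space_bound)
    show "integrable M (\<lambda>x. A powr (p - 1) * (LINT t|M. ?F x t))"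
      using J_int by simp
    show "(\<lambda>x. convol M sub \<phi> f x - f x) \<in> borel_measurable M"
      unfolding convol_def by measurable
  qed (use pointwise in auto)

  have out_int: "integrable M (\<lambda>t. indicator (space M - nbh N) t * norm (\<phi> t))"
    using integrable_mult_indicator[of "space M - nbh N" M "\<lambda>t. norm (\<phi> t)"] \<phi>_int by simp
  have "Lp_pow M p (\<lambda>x. convol M sub \<phi> f x - f x) \<le> (LINT x|M. A powr (p - 1) * (LINT t|M. ?F x t))"
    unfolding Lp_pow_def using J_int by (intro integral_mono Lp_space_integrable[OF L] pointwise) auto
  also have "\<dots> = A powr (p - 1) * (LINT t|M. norm (\<phi> t) * ?\<omega> t)"
    by (simp add: J)
  also have "(LINT t|M. norm (\<phi> t) * ?\<omega> t) \<le>
      (LINT t|M. e * norm (\<phi> t) + ?K * (indicator (space M - nbh N) t * norm (\<phi> t)))"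
  proof (rule integral_mono[OF \<phi>\<omega>_int])
    show "integrable M (\<lambda>t. e * norm (\<phi> t) + ?K * (indicator (space M - nbh N) t * norm (\<phi> t)))"
      using \<phi>_int out_int by (intro Bochner_Integration.integrable_add integrable_mult_right) auto
    fix t assume t: "t \<in> space M"
    show "norm (\<phi> t) * ?\<omega> t \<le> e * norm (\<phi> t) + ?K * (indicator (space M - nbh N) t * norm (\<phi> t))"
    proof (cases "t \<in> nbh N")
      case True
      then show ?thesis
        using mult_right_mono[OF e[OF True], of "norm (\<phi> t)"] by (simp add: mult.commute)
    next
      case False
      then have "norm (\<phi> t) * ?\<omega> t \<le> ?K * (indicator (space M - nbh N) t * norm (\<phi> t))"
      proof -
        have "indicator (space M - nbh N) t = (1 :: real)" using t False by simp
        then show ?thesis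
          using mult_left_mono[OF \<omega>_le[OF t] norm_ge_zero, of "\<phi> t"]
          by (simp only: mult_1 mult.commute[of "norm (\<phi> t)"])
      qed
      then show ?thesis
        by (rule add_increasing[OF mult_nonneg_nonneg[OF e_nonneg norm_ge_zero]])
    qed
  qed
  also have "\<dots> = e * A + ?K * (LINT t:(space M - nbh N)|M. norm (\<phi> t))"
    using \<phi>_int out_int by (simp add: A_def set_lebesgue_integral_def)
  finally show "Lp_pow M p (\<lambda>x. convol M sub \<phi> f x - f x) \<le>
      A powr (p - 1) * (e * A + ?K * (LINT t:(space M - nbh N)|M. norm (\<phi> t)))"
    by (simp add: mult_left_mono)
qed

text \<open>First e is fixed through the bound B of (A2), then N by continuity of translations, then
  n by (A3). Membership in L_p is recorded as well because \<open>Lp_norm\<close> has a meaning only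
  there.\<close>

theorem approximate_identity_Lp:
  assumes p: "1 \<le> p" and f: "f \<in> Lp_space M p" and \<Phi>: "approximate_identity M nbh \<Phi>"
  shows "\<And>n. 1 \<le> n \<Longrightarrow> (\<lambda>x. convol M sub (\<Phi> n) f x - f x) \<in> Lp_space M p"
    and "(\<lambda>n. Lp_norm M p (\<lambda>x. convol M sub (\<Phi> n) f x - f x)) \<longlonglongrightarrow> 0"
proof -
  have Linf: "\<Phi> n \<in> Linf_space M" and int1: "(LINT t|M. \<Phi> n t) = 1" if "1 \<le> n" for n
    using \<Phi> that by (auto simp: approximate_identity_def)
  show "(\<lambda>x. convol M sub (\<Phi> n) f x - f x) \<in> Lp_space M p" if "1 \<le> n" for n
  proof (rule convol_diff_bound(1)[OF p f Linf[OF that] int1[OF that]])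
    \<comment> \<open>For membership any bound on \<omega> will do; this one comes from translation
      invariance, with N = 0.\<close>
    show "Lp_pow M p (\<lambda>x. f (sub x t) - f x) \<le> 2 powr p * (Lp_pow M p f + Lp_pow M p f)"
      if "t \<in> nbh 0" for t
      using Lp_space_diff(2)[OF Lp_translate(1)[OF f nbh_space[OF that]] f]
        Lp_translate(2)[OF f nbh_space[OF that]] p by simp
  qed (simp add: Lp_pow_nonneg)
  let ?A = "\<lambda>n. LINT t|M. norm (\<Phi> n t)"
  let ?K = "2 powr p * (2 * Lp_pow M p f)"
  obtain B where B: "\<And>n. 1 \<le> n \<Longrightarrow> ?A n \<le> B"
    using \<Phi> by (fastforce simp: approximate_identity_def bdd_above_def)
  have A1: "1 \<le> ?A n" if "1 \<le> n" for n
    using integral_norm_bound[of M "\<Phi> n"] int1[OF that] by simp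
  then have B1: "1 \<le> B"
    using order_trans[OF A1[of 1] B[of 1]] by simp
  have "(\<lambda>n. Lp_pow M p (\<lambda>x. convol M sub (\<Phi> n) f x - f x)) \<longlonglongrightarrow> 0"
  proof (rule tendstoI)
    fix \<epsilon> :: real assume \<epsilon>: "0 < \<epsilon>"
    have ct: "((\<lambda>t. Lp_pow M p (\<lambda>x. f (sub x t) - f x)) \<longlongrightarrow> 0) near"
      using translation_continuous_Lp[OF _ f] p by (simp add: translation_continuous_def)
    \<comment> \<open>The share of I_N is at most B^(p-1) e B, which this choice makes \<epsilon> /
      2.\<close>
    define e where "e = \<epsilon> / (2 * (B powr (p - 1) * B))"
    have e: "0 < e" using \<epsilon> B1 by (simp add: e_def)
    obtain N where N: "1 \<le> N" "\<And>t. t \<in> nbh N \<Longrightarrow> Lp_pow M p (\<lambda>x. f (sub x t) - f x) < e"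
      using order_tendstoD(2)[OF ct e] by (auto simp: eventually_near)
    let ?out = "\<lambda>n. LINT t:(space M - nbh N)|M. norm (\<Phi> n t)"
    have "?out \<longlonglongrightarrow> 0"
      using \<Phi> N(1) by (auto simp: approximate_identity_def)
    then have "(\<lambda>n. B powr (p - 1) * (?K * ?out n)) \<longlonglongrightarrow> 0"
      by (intro tendsto_mult_right_zero)
    then have "eventually (\<lambda>n. B powr (p - 1) * (?K * ?out n) < \<epsilon> / 2) sequentially"
      using \<epsilon> by (intro order_tendstoD(2)[of _ 0]) auto
    then show "eventually (\<lambda>n. dist (Lp_pow M p (\<lambda>x. convol M sub (\<Phi> n) f x - f x)) 0 < \<epsilon>) sequentially"
      using eventually_ge_at_top[of 1]
    proof eventually_elim
      case (elim n)
      note bound = convol_diff_bound[OF p f Linf[OF elim(2)] int1[OF elim(2)] less_imp_le[OF N(2)] less_imp_le[OF e]]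
      have out: "0 \<le> ?out n"
        by (auto simp: set_lebesgue_integral_def intro!: integral_nonneg_AE)
      have "Lp_pow M p (\<lambda>x. convol M sub (\<Phi> n) f x - f x) \<le>
          ?A n powr (p - 1) * (e * ?A n + ?K * ?out n)"
        using bound(2) .
      also have "\<dots> \<le> B powr (p - 1) * (e * B + ?K * ?out n)"
      proof (rule mult_mono)
        show "?A n powr (p - 1) \<le> B powr (p - 1)"
          using A1[OF elim(2)] B[OF elim(2)] p by (intro powr_mono2) auto
        show "e * ?A n + ?K * ?out n \<le> e * B + ?K * ?out n"
          using B[OF elim(2)] e by (intro add_right_mono mult_left_mono) auto
        show "0 \<le> e * ?A n + ?K * ?out n"
          using A1[OF elim(2)] e out Lp_pow_nonneg[of M p f]
          by (intro add_nonneg_nonneg mult_nonneg_nonneg) auto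
      qed simp
      also have "\<dots> = \<epsilon> / 2 + B powr (p - 1) * (?K * ?out n)"
      proof -
        have "B powr (p - 1) * (e * B) = \<epsilon> / 2"
          using B1 by (simp add: e_def)
        then show ?thesis by (simp only: distrib_left)
      qed
      also have "\<dots> < \<epsilon>" using elim(1) by simp
      finally show ?case by (simp add: Lp_pow_nonneg)
    qed
  qed
  then show "(\<lambda>n. Lp_norm M p (\<lambda>x. convol M sub (\<Phi> n) f x - f x)) \<longlonglongrightarrow> 0"
    using p by (intro Lp_norm_tendsto_0) auto
qed

end

section \<open>Passing to the completed measure\<close>

lemma completion_ex_borel_measurable_complex:
  fixes g :: "'a \<Rightarrow> complex"
  assumes [measurable]: "g \<in> borel_measurable (completion M)"
  shows "\<exists>g'\<in>borel_measurable M. AE x in M. g x = g' x"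
proof -
  obtain r where [measurable]: "r \<in> borel_measurable M" and r: "AE x in M. Re (g x) = r x"
    using completion_ex_borel_measurable_real[of "\<lambda>x. Re (g x)" M] by auto
  obtain i where [measurable]: "i \<in> borel_measurable M" and i: "AE x in M. Im (g x) = i x"
    using completion_ex_borel_measurable_real[of "\<lambda>x. Im (g x)" M] by auto
  from r i have "AE x in M. g x = complex_of_real (r x) + \<i> * complex_of_real (i x)"
    by eventually_elim (simp add: complex_eq_iff)
  then show ?thesis
    by (intro bexI[of _ "\<lambda>x. complex_of_real (r x) + \<i> * complex_of_real (i x)"]) auto
qed

text \<open>Preimages under h and h' differ by a null set, and a complete measure measures every set
  that agrees almost everywhere with a measurable one.\<close>

lemma borel_measurable_completion_AE:
  fixes h h' :: "'a \<Rightarrow> 'b::topological_space"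
  assumes [measurable]: "h' \<in> borel_measurable M" and ae: "AE x in M. h x = h' x"
  shows "h \<in> borel_measurable (completion M)"
proof (rule measurableI)
  fix A :: "'b set" assume [measurable]: "A \<in> sets borel"
  show "h -` A \<inter> space (completion M) \<in> sets (completion M)"
  proof (rule completion.in_sets_AE)
    show "AE x in completion M. (x \<in> h' -` A \<inter> space M) = (x \<in> h -` A \<inter> space (completion M))"
      using AE_completion[OF ae] by eventually_elim auto
  qed auto
qed auto

lemma
  fixes h h' :: "'a \<Rightarrow> 'b::{banach, second_countable_topology}"
  assumes h' [measurable]: "h' \<in> borel_measurable M" and ae: "AE x in M. h x = h' x"
  shows integrable_completion_AE: "integrable (completion M) h \<longleftrightarrow> integrable M h'"
    and integral_completion_AE: "(LINT x|completion M. h x) = (LINT x|M. h' x)"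
proof -
  have [measurable]: "h \<in> borel_measurable (completion M)" "h' \<in> borel_measurable (completion M)"
    using borel_measurable_completion_AE[OF h' ae] measurable_completion[OF h'] by auto
  have "integrable (completion M) h \<longleftrightarrow> integrable (completion M) h'"
    by (intro integrable_cong_AE AE_completion ae) auto
  then show "integrable (completion M) h \<longleftrightarrow> integrable M h'"
    by (simp add: integrable_completion)
  have "(LINT x|completion M. h x) = (LINT x|completion M. h' x)"
    by (intro integral_cong_AE AE_completion ae) auto
  then show "(LINT x|completion M. h x) = (LINT x|M. h' x)"
    by (simp add: integral_completion)
qed

lemma
  assumes h' [measurable]: "h' \<in> borel_measurable M" and ae: "AE x in M. h x = h' x"
  shows Lp_space_completion_AE: "h \<in> Lp_space (completion M) p \<longleftrightarrow> h' \<in> Lp_space M p"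
    and Lp_norm_completion_AE: "Lp_norm (completion M) p h = Lp_norm M p h'"
proof -
  have ae': "AE x in M. norm (h x) powr p = norm (h' x) powr p"
    using ae by eventually_elim simp
  have m: "(\<lambda>x. norm (h' x) powr p) \<in> borel_measurable M"
    by measurable
  show "h \<in> Lp_space (completion M) p \<longleftrightarrow> h' \<in> Lp_space M p"
    using borel_measurable_completion_AE[OF h' ae] integrable_completion_AE[OF m ae']
    by (simp add: Lp_space_def)
  show "Lp_norm (completion M) p h = Lp_norm M p h'"
    using integral_completion_AE[OF m ae'] by (simp add: Lp_norm_def)
qed

context translation_space
begin

text \<open>The map t \<mapsto> x - t preserves the measure, so f(x - t) and f'(x - t) agree for
  almost every t. Hence the convolutions coincide at every x, not just almost everywhere.\<close>

lemma convol_completion: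
  assumes [measurable]: "\<phi>' \<in> borel_measurable M" "f' \<in> borel_measurable M"
    and \<phi>: "AE t in M. \<phi> t = \<phi>' t" and f: "AE t in M. f t = f' t" and x: "x \<in> space M"
  shows "convol (completion M) sub \<phi> f x = convol M sub \<phi>' f' x"
  unfolding convol_def
proof (rule integral_completion_AE)
  note [measurable] = x
  show "(\<lambda>t. \<phi>' t * f' (sub x t)) \<in> borel_measurable M"
    by measurable
  have "AE t in M. f (sub x t) = f' (sub x t)"
  proof (rule AE_distrD[where P = "\<lambda>t. f t = f' t"])
    show "AE t in distr M M (\<lambda>t. sub x t). f t = f' t"
      using f by (subst distr_sub_left[OF x])
  qed measurable
  with \<phi> show "AE t in M. \<phi> t * f (sub x t) = \<phi>' t * f' (sub x t)"
    by eventually_elim simp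
qed

text \<open>All conditions are integrals or essential bounds, which ignore null sets. The families
  are compared from index 1 on, so the limit in (A3) passes over by eventual equality.\<close>

lemma approximate_identity_completion:
  assumes [measurable]: "\<And>n. \<Phi>' n \<in> borel_measurable M"
    and ae: "\<And>n. 1 \<le> n \<Longrightarrow> AE x in M. \<Phi> n x = \<Phi>' n x"
    and \<Phi>: "approximate_identity (completion M) nbh \<Phi>"
  shows "approximate_identity M nbh \<Phi>'"
proof -
  note [measurable] = nbh_sets
  have norm: "(LINT x|completion M. norm (\<Phi> n x)) = (LINT x|M. norm (\<Phi>' n x))" if "1 \<le> n" for n
    using ae[OF that] by (intro integral_completion_AE) auto
  have 1: "\<Phi>' n \<in> Linf_space M" if n: "1 \<le> n" for n
  proof -
    obtain C where "AE x in M. norm (\<Phi> n x) \<le> C"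
      using \<Phi> n by (auto simp: approximate_identity_def Linf_space_def AE_completion_iff)
    with ae[OF n] have "AE x in M. norm (\<Phi>' n x) \<le> C"
      by eventually_elim simp
    then show ?thesis by (auto simp: Linf_space_def)
  qed
  have 2: "(LINT x|M. \<Phi>' n x) = 1" if n: "1 \<le> n" for n
    using \<Phi> n integral_completion_AE[OF _ ae[OF n]] by (simp add: approximate_identity_def)
  have 3: "bdd_above ((\<lambda>n. LINT x|M. norm (\<Phi>' n x)) ` {1..})"
  proof -
    have "(\<lambda>n. LINT x|M. norm (\<Phi>' n x)) ` {1..} = (\<lambda>n. LINT x|completion M. norm (\<Phi> n x)) ` {1..}"
      using norm by (intro image_cong) auto
    then show ?thesis using \<Phi> by (simp add: approximate_identity_def)
  qed
  have 4: "(\<lambda>n. LINT x:(space M - nbh N)|M. norm (\<Phi>' n x)) \<longlonglongrightarrow> 0" if N: "1 \<le> N" for N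
  proof -
    have eq: "(LINT x:(space M - nbh N)|completion M. norm (\<Phi> n x)) =
        (LINT x:(space M - nbh N)|M. norm (\<Phi>' n x))" if "1 \<le> n" for n
      unfolding set_lebesgue_integral_def
      using ae[OF that] by (intro integral_completion_AE) auto
    have "(\<lambda>n. LINT x:(space M - nbh N)|completion M. norm (\<Phi> n x)) \<longlonglongrightarrow> 0"
      using \<Phi> N by (simp add: approximate_identity_def)
    then show ?thesis
      by (rule Lim_transform_eventually) (rule eventually_mono[OF eventually_ge_at_top[of 1]], rule eq)
  qed
  show ?thesis
    using 1 2 3 4 by (simp add: approximate_identity_def)
qed

text \<open>With Borel representatives of f and of all kernels, the two error functions agree almost
  everywhere, hence so do their norms.\<close>

theorem approximate_identity_Lp_completion:
  assumes p: "1 \<le> p" and f: "f \<in> Lp_space (completion M) p"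
    and \<Phi>: "approximate_identity (completion M) nbh \<Phi>"
  shows "\<And>n. 1 \<le> n \<Longrightarrow> (\<lambda>x. convol (completion M) sub (\<Phi> n) f x - f x) \<in> Lp_space (completion M) p"
    and "(\<lambda>n. Lp_norm (completion M) p (\<lambda>x. convol (completion M) sub (\<Phi> n) f x - f x)) \<longlonglongrightarrow> 0"
proof -
  obtain f' where f' [measurable]: "f' \<in> borel_measurable M" and ff': "AE x in M. f x = f' x"
    using completion_ex_borel_measurable_complex[of f M] f by (auto simp: Lp_space_def)
  have f'L: "f' \<in> Lp_space M p"
    using f Lp_space_completion_AE[OF f' ff'] by simp
  \<comment> \<open>The kernel at index 0 is arbitrary and may fail to be measurable; the zero
    function stands in for it.\<close>
  have "\<exists>g\<in>borel_measurable M. 1 \<le> n \<longrightarrow> (AE x in M. \<Phi> n x = g x)" for n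
  proof (cases "1 \<le> n")
    case True
    then have "\<Phi> n \<in> borel_measurable (completion M)"
      using \<Phi> by (auto simp: approximate_identity_def Linf_space_def)
    from completion_ex_borel_measurable_complex[OF this] show ?thesis by auto
  next
    case False
    then show ?thesis by (intro bexI[of _ "\<lambda>_. 0"]) auto
  qed
  then obtain \<Phi>' where \<Phi>' [measurable]: "\<And>n. \<Phi>' n \<in> borel_measurable M"
    and \<Phi>\<Phi>': "\<And>n. 1 \<le> n \<Longrightarrow> AE x in M. \<Phi> n x = \<Phi>' n x"
    by metis
  have "approximate_identity M nbh \<Phi>'"
    by (rule approximate_identity_completion[OF \<Phi>' _ \<Phi>]) (rule \<Phi>\<Phi>')
  note A = approximate_identity_Lp[OF p f'L this]
  have m: "(\<lambda>x. convol M sub (\<Phi>' n) f' x - f' x) \<in> borel_measurable M" for n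
    unfolding convol_def by measurable
  have ae: "AE x in M. convol (completion M) sub (\<Phi> n) f x - f x = convol M sub (\<Phi>' n) f' x - f' x"
    if "1 \<le> n" for n
    using ff' AE_space
    by eventually_elim (simp add: convol_completion[OF \<Phi>' f' \<Phi>\<Phi>'[OF that] ff'])
  show "(\<lambda>x. convol (completion M) sub (\<Phi> n) f x - f x) \<in> Lp_space (completion M) p" if "1 \<le> n" for n
    using Lp_space_completion_AE[OF m ae[OF that]] A(1)[OF that] by simp
  show "(\<lambda>n. Lp_norm (completion M) p (\<lambda>x. convol (completion M) sub (\<Phi> n) f x - f x)) \<longlonglongrightarrow> 0"
    by (rule Lim_transform_eventually[OF A(2)])
      (rule eventually_mono[OF eventually_ge_at_top[of 1]], rule Lp_norm_completion_AE[OF m ae, symmetric])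
qed

end

section \<open>The group \<open>G\<^sub>m\<close>\<close>

context
  fixes m :: "nat \<Rightarrow> int"
  assumes m: "\<And>k. 2 \<le> m k"
begin

private abbreviation (input) "V \<equiv> vilenkin_measure m"

lemma prob_space_factor: "prob_space (uniform_count_measure {0..<m k})"
  using m[of k] by (intro prob_space_uniform_count_measure) auto

lemma space_vilenkin: "space V = {x. \<forall>k. x k \<in> {0..<m k}}"
  by (auto simp: vilenkin_measure_def space_PiM space_uniform_count_measure PiE_def)

text \<open>With the discrete space of all integers as target, the coordinates share one target and
  every function of a coordinate is measurable.\<close>

lemma measurable_coordinate [measurable]: "(\<lambda>x. x k) \<in> V \<rightarrow>\<^sub>M count_space UNIV"
proof -
  have "(\<lambda>x. x k) \<in> V \<rightarrow>\<^sub>M count_space {0..<m k}"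
    unfolding vilenkin_measure_def
    using measurable_component_singleton[of k UNIV "\<lambda>k. uniform_count_measure {0..<m k}"]
    by (simp cong: measurable_cong_sets)
  then show ?thesis
    by (rule measurable_compose) simp
qed

lemma measurable_into_vilenkin:
  assumes "\<And>k. (\<lambda>x. g x k) \<in> N \<rightarrow>\<^sub>M count_space UNIV" and "\<And>x k. x \<in> space N \<Longrightarrow> g x k \<in> {0..<m k}"
  shows "g \<in> N \<rightarrow>\<^sub>M V"
  unfolding vilenkin_measure_def
proof (rule measurable_PiM_single')
  show "(\<lambda>x. g x k) \<in> N \<rightarrow>\<^sub>M uniform_count_measure {0..<m k}" for k
  proof (rule measurableI)
    fix A assume "A \<in> sets (uniform_count_measure {0..<m k})"
    show "(\<lambda>x. g x k) -` A \<inter> space N \<in> sets N"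
      by (rule measurable_sets[OF assms(1)]) simp
  qed (use assms(2) in \<open>auto simp: space_uniform_count_measure\<close>)
qed (use assms(2) in \<open>auto simp: space_uniform_count_measure\<close>)

text \<open>Finite measures on the product that agree on cylinders are equal. Permuting each factor
  pulls a cylinder back to a cylinder whose base sets have the same cardinalities, hence the same
  uniform measures.\<close>

lemma distr_coordinatewise:
  assumes \<sigma>: "\<And>k. bij_betw (\<sigma> k) {0..<m k} {0..<m k}"
  shows "distr V V (\<lambda>t k. \<sigma> k (t k)) = V"
proof -
  let ?U = "\<lambda>k. uniform_count_measure {0..<m k}"
  let ?f = "\<lambda>t k. \<sigma> k (t k)"
  have range: "\<sigma> k a \<in> {0..<m k}" if "a \<in> {0..<m k}" for k a
    using \<sigma>[of k] that by (auto simp: bij_betw_def)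
  have f_space: "?f t k \<in> {0..<m k}" if "t \<in> space V" for t k
    using that by (intro range) (simp add: space_vilenkin)
  have f: "?f \<in> V \<rightarrow>\<^sub>M V"
  proof (rule measurable_into_vilenkin)
    show "(\<lambda>x. \<sigma> k (x k)) \<in> V \<rightarrow>\<^sub>M count_space UNIV" for k
      by (rule measurable_compose[OF measurable_coordinate]) simp
  qed (rule f_space)
  show ?thesis
  proof (rule measure_eqI_PiM_infinite[symmetric, of _ UNIV ?U])
    fix A :: "nat \<Rightarrow> int set" and J :: "nat set"
    assume J: "finite J" and A: "\<And>i. i \<in> J \<Longrightarrow> A i \<in> sets (?U i)"
    let ?B = "\<lambda>k. \<sigma> k -` A k \<inter> {0..<m k}"
    have A': "A i \<subseteq> {0..<m i}" if "i \<in> J" for i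
      using A[OF that] by (simp add: sets_uniform_count_measure)
    have "?f -` prod_emb UNIV ?U J (Pi\<^sub>E J A) \<inter> space V = prod_emb UNIV ?U J (Pi\<^sub>E J ?B)"
      using f_space by (auto simp: prod_emb_def space_vilenkin space_uniform_count_measure PiE_iff)
    then have "emeasure (distr V V ?f) (prod_emb UNIV ?U J (Pi\<^sub>E J A)) =
        emeasure V (prod_emb UNIV ?U J (Pi\<^sub>E J ?B))"
      using J A by (subst emeasure_distr[OF f]) (auto simp: vilenkin_measure_def intro!: sets_PiM_I)
    also have "\<dots> = (\<Prod>i\<in>J. emeasure (?U i) (?B i))"
      unfolding vilenkin_measure_def
      by (intro emeasure_PiM_emb prob_space_factor J) (auto simp: sets_uniform_count_measure)
    also have "\<dots> = (\<Prod>i\<in>J. emeasure (?U i) (A i))"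
    proof (rule prod.cong[OF refl])
      fix i assume i: "i \<in> J"
      have "\<sigma> i ` ?B i = A i"
      proof (intro equalityI subsetI)
        fix a assume a: "a \<in> A i"
        then have "a \<in> \<sigma> i ` {0..<m i}"
          using \<sigma>[of i] A'[OF i] by (simp only: bij_betw_def) blast
        with a show "a \<in> \<sigma> i ` ?B i" by blast
      qed blast
      moreover have "inj_on (\<sigma> i) (?B i)"
        using \<sigma>[of i] by (auto simp: bij_betw_def intro: inj_on_subset)
      ultimately have "card (?B i) = card (A i)"
        using card_image by metis
      then show "emeasure (?U i) (?B i) = emeasure (?U i) (A i)"
        using A'[OF i] by (simp add: emeasure_uniform_count_measure)
    qed
    also have "\<dots> = emeasure V (prod_emb UNIV ?U J (Pi\<^sub>E J A))"
      unfolding vilenkin_measure_def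
      by (intro emeasure_PiM_emb[symmetric] prob_space_factor J A) auto
    finally show "emeasure V (prod_emb UNIV ?U J (Pi\<^sub>E J A)) =
        emeasure (distr V V ?f) (prod_emb UNIV ?U J (Pi\<^sub>E J A))" ..
  next
    show "finite_measure V"
      unfolding vilenkin_measure_def
      by (intro prob_space.finite_measure prob_space_PiM prob_space_factor)
  qed (simp_all add: vilenkin_measure_def)
qed

text \<open>The value c = 1 gives the shifts x \<mapsto> x - t, and c = -1 the reflections t
  \<mapsto> x - t. Injectivity suffices, since an injective self-map of a finite set is
  onto.\<close>

lemma bij_betw_affine_mod:
  assumes "\<bar>c\<bar> = 1"
  shows "bij_betw (\<lambda>s. (c * s + d) mod m k) {0..<m k} {0..<m k}"
proof -
  have "inj_on (\<lambda>s. (c * s + d) mod m k) {0..<m k}"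
  proof (rule inj_onI)
    fix a b assume a: "a \<in> {0..<m k}" "b \<in> {0..<m k}" and "(c * a + d) mod m k = (c * b + d) mod m k"
    then have "m k dvd (c * a + d) - (c * b + d)"
      by (simp add: mod_eq_dvd_iff)
    also have "(c * a + d) - (c * b + d) = c * (a - b)"
      by (simp add: algebra_simps)
    finally have "m k dvd a - b"
      using assms dvd_diff_commute[of "m k" a b] by (auto simp: abs_if split: if_splits)
    then show "a = b"
      using a by (auto simp flip: mod_eq_dvd_iff)
  qed
  moreover have "(\<lambda>s. (c * s + d) mod m k) ` {0..<m k} \<subseteq> {0..<m k}"
    using m[of k] by auto
  ultimately show ?thesis
    by (simp add: bij_betw_def endo_inj_surj)
qed

text \<open>The generators are cylinders, which restrict finitely many coordinates. Subtracting t in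
  I_N leaves the first N coordinates unchanged, so for large N no point enters or leaves the
  cylinder.\<close>

lemma translation_space_vilenkin:
  "translation_space V (vilenkin_minus m) (vilenkin_nbh m)
     (prod_algebra UNIV (\<lambda>k. uniform_count_measure {0..<m k}))"
proof -
  let ?U = "\<lambda>k. uniform_count_measure {0..<m k}"
  interpret prob_space V
    unfolding vilenkin_measure_def by (intro prob_space_PiM prob_space_factor)
  show ?thesis
  proof unfold_locales
    show "(\<lambda>(x, t). vilenkin_minus m x t) \<in> V \<Otimes>\<^sub>M V \<rightarrow>\<^sub>M V"
    proof (rule measurable_into_vilenkin)
      fix k
      \<comment> \<open>The first coordinate takes countably many values, so it may be held fixed
        while measurability in the second is checked.\<close>
      have "(\<lambda>z. (fst z k - snd z k) mod m k) \<in> V \<Otimes>\<^sub>M V \<rightarrow>\<^sub>M count_space UNIV"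
      proof (rule measurable_compose_countable[where g = "\<lambda>z. fst z k" and f = "\<lambda>i z. (i - snd z k) mod m k"])
        show "(\<lambda>z. (i - snd z k) mod m k) \<in> V \<Otimes>\<^sub>M V \<rightarrow>\<^sub>M count_space UNIV" for i
          by (rule measurable_compose[where f = "\<lambda>z. snd z k" and N = "count_space UNIV"]) measurable
      qed measurable
      then show "(\<lambda>z. (case z of (x, t) \<Rightarrow> vilenkin_minus m x t) k) \<in> V \<Otimes>\<^sub>M V \<rightarrow>\<^sub>M count_space UNIV"
        by (simp add: vilenkin_minus_def case_prod_beta')
    next
      show "(case z of (x, t) \<Rightarrow> vilenkin_minus m x t) k \<in> {0..<m k}" for z k
        using m[of k] by (auto simp: vilenkin_minus_def split: prod.split)
    qed
    show "distr V V (\<lambda>t. vilenkin_minus m x t) = V" for x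
      using distr_coordinatewise[OF bij_betw_affine_mod[of "-1" "x _"]]
      by (simp add: vilenkin_minus_def)
    show "distr V V (\<lambda>x. vilenkin_minus m x t) = V" for t
      using distr_coordinatewise[OF bij_betw_affine_mod[of 1 "- t _"]]
      by (simp add: vilenkin_minus_def)
    show "vilenkin_nbh m N \<in> sets V" for N
      unfolding vilenkin_nbh_def by measurable
    show "antimono (vilenkin_nbh m)"
      by (auto simp: antimono_def vilenkin_nbh_def)
    show "sets V = sigma_sets (space V) (prod_algebra UNIV ?U)"
      by (simp add: vilenkin_measure_def sets_PiM space_PiM)
    show "Int_stable (prod_algebra UNIV ?U)"
      by (rule Int_stable_prod_algebra)
    show "prod_algebra UNIV ?U \<subseteq> Pow (space V)"
      using prod_algebra_sets_into_space by (simp add: vilenkin_measure_def space_PiM)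
    show "\<exists>N\<ge>1. \<forall>t\<in>vilenkin_nbh m N.
        measure V {x \<in> space V. (vilenkin_minus m x t \<in> A) \<noteq> (x \<in> A)} < e"
      if A: "A \<in> prod_algebra UNIV ?U" and e: "0 < e" for A and e :: real
    proof -
      obtain J E where J: "finite J" and AE: "A = prod_emb UNIV ?U J (Pi\<^sub>E J E)"
        using A by (rule prod_algebraE)
      obtain N where N: "J \<subseteq> {..<N}"
        using J by (auto simp: finite_nat_iff_bounded)
      have memA: "y \<in> A \<longleftrightarrow> (\<forall>k. y k \<in> {0..<m k}) \<and> (\<forall>k\<in>J. y k \<in> E k)" for y
        by (simp add: AE prod_emb_def space_uniform_count_measure PiE_iff) auto
      \<comment> \<open>The successor guarantees a positive index even when J is empty and N is
        0.\<close>
      have unmoved: "{x \<in> space V. (vilenkin_minus m x t \<in> A) \<noteq> (x \<in> A)} = {}"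
        if t: "t \<in> vilenkin_nbh m (Suc N)" for t
      proof -
        have "vilenkin_minus m x t k = x k" if "x \<in> space V" "k \<in> J" for x k
        proof -
          have "k < Suc N" using N \<open>k \<in> J\<close> by auto
          then have "t k = 0" using t by (auto simp: vilenkin_nbh_def)
          then show ?thesis
            using \<open>x \<in> space V\<close> by (simp add: vilenkin_minus_def space_vilenkin)
        qed
        moreover have "vilenkin_minus m x t k \<in> {0..<m k}" for x k
          using m[of k] by (simp add: vilenkin_minus_def)
        moreover have "x k \<in> {0..<m k}" if "x \<in> space V" for x k
          using that by (simp add: space_vilenkin)
        ultimately show ?thesis
          unfolding memA set_eq_iff mem_Collect_eq empty_iff by (metis (full_types))
      qed
      show ?thesis
        using e by (intro exI[of _ "Suc N"] conjI ballI, simp, subst unmoved) auto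
    qed
  qed
qed

end

section \<open>The interval \<open>[-\<pi>, \<pi>]\<close>\<close>

text \<open>The null sets of the restricted measure are the null sets of M inside S, so both sides
  consist of the same unions of a measurable set and a part of a null set. As
  \<open>lebesgue_on\<close> restricts a completion, this exhibits \<open>trig_measure\<close> as a
  completion.\<close>

lemma completion_restrict_space:
  assumes S: "S \<in> sets M"
  shows "completion (restrict_space M S) = restrict_space (completion M) S"
proof (rule measure_eqI)
  have S': "S \<inter> space M \<in> sets M" "S \<inter> space (completion M) \<in> sets (completion M)"
    using S by auto
  have null: "N \<in> null_sets (restrict_space M S) \<longleftrightarrow> N \<subseteq> S \<and> N \<in> null_sets M" for N
    by (rule null_sets_restrict_space[OF S])
  show eq: "sets (completion (restrict_space M S)) = sets (restrict_space (completion M) S)"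
  proof (intro equalityI subsetI)
    fix A assume "A \<in> sets (completion (restrict_space M S))"
    then obtain B N N' where A: "A = B \<union> N" "N \<subseteq> N'"
      and "N' \<in> null_sets (restrict_space M S)" "B \<in> sets (restrict_space M S)"
      by (rule sets_completionE)
    then have N': "N' \<subseteq> S" "N' \<in> null_sets M" and B: "B \<subseteq> S" "B \<in> sets M"
      using S by (auto simp: null sets_restrict_space_iff)
    have "A \<in> sets (completion M)" "A \<subseteq> S"
      using A N' B by (auto intro: sets_completionI)
    then show "A \<in> sets (restrict_space (completion M) S)"
      using S'(2) by (simp add: sets_restrict_space_iff)
  next
    fix A assume "A \<in> sets (restrict_space (completion M) S)"
    then have AS: "A \<subseteq> S" and "A \<in> sets (completion M)"
      using S'(2) by (auto simp: sets_restrict_space_iff)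
    then obtain B N N' where A: "A = B \<union> N" "N \<subseteq> N'" "N' \<in> null_sets M" "B \<in> sets M"
      by (auto elim: sets_completionE)
    show "A \<in> sets (completion (restrict_space M S))"
    proof (rule sets_completionI)
      show "N \<subseteq> N' \<inter> S" using A AS by auto
      show "N' \<inter> S \<in> null_sets (restrict_space M S)"
        using A(3) S by (auto simp: null null_set_Int2)
      show "B \<in> sets (restrict_space M S)"
        using A AS S' by (auto simp: sets_restrict_space_iff)
    qed (rule A)
  qed
  fix A assume A: "A \<in> sets (completion (restrict_space M S))"
  then obtain B N N' where AB: "A = B \<union> N" "N \<subseteq> N'"
    and N': "N' \<in> null_sets (restrict_space M S)" and B: "B \<in> sets (restrict_space M S)"
    by (rule sets_completionE)
  have NS: "N \<in> null_sets (completion (restrict_space M S))" "N \<in> null_sets (completion M)"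
    using AB(2) N' null by (auto simp: null_sets_completion_iff2)
  have BS: "B \<in> sets M" "B \<subseteq> S"
    using B S' by (auto simp: sets_restrict_space_iff)
  have AS: "A \<subseteq> S"
    using A S' unfolding eq by (auto simp: sets_restrict_space_iff)
  have "emeasure (completion (restrict_space M S)) A = emeasure (restrict_space M S) B"
    using B NS(1) by (simp add: AB emeasure_Un_null_set)
  also have "\<dots> = emeasure M B"
    using S' BS by (simp add: emeasure_restrict_space)
  also have "\<dots> = emeasure (completion M) A"
    using BS NS(2) by (simp add: AB emeasure_Un_null_set)
  also have "\<dots> = emeasure (restrict_space (completion M) S) A"
    using S' AS by (simp add: emeasure_restrict_space)
  finally show "emeasure (completion (restrict_space M S)) A = emeasure (restrict_space (completion M) S) A" .
qed

section \<open>The trigonometric measure on Borel sets\<close>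

definition trig_borel :: "real measure" where
  "trig_borel = density (restrict_space lborel {-pi..pi}) (\<lambda>x. ennreal (1 / (2 * pi)))"

lemma trig_measure_eq_completion: "trig_measure = completion trig_borel"
  unfolding trig_measure_def trig_borel_def
  by (subst completion_density_eq) (auto simp: completion_restrict_space)

lemma space_trig_borel [simp]: "space trig_borel = {-pi..pi}"
  by (simp add: trig_borel_def space_restrict_space)

lemma sets_trig_borel [measurable_cong]: "sets trig_borel = sets (restrict_space borel {-pi..pi})"
  by (simp add: trig_borel_def cong: sets_restrict_space_cong)

lemma sets_trig_borel_iff: "A \<in> sets trig_borel \<longleftrightarrow> A \<in> sets borel \<and> A \<subseteq> {-pi..pi}"
  by (auto simp: sets_trig_borel sets_restrict_space_iff)

lemma emeasure_trig_borel:
  assumes "A \<in> sets trig_borel"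
  shows "emeasure trig_borel A = ennreal (1 / (2 * pi)) * emeasure lborel A"
proof -
  have A: "A \<in> sets (restrict_space lborel {-pi..pi})" "A \<subseteq> {-pi..pi}"
    using assms by (auto simp: sets_trig_borel_iff sets_restrict_space_iff)
  then show ?thesis
    by (simp add: trig_borel_def emeasure_density nn_integral_cmult_indicator emeasure_restrict_space)
qed

lemma prob_space_trig_borel: "prob_space trig_borel"
proof
  have "emeasure trig_borel {-pi..pi} = ennreal (1 / (2 * pi)) * ennreal (2 * pi)"
    by (subst emeasure_trig_borel) (auto simp: sets_trig_borel_iff)
  then show "emeasure trig_borel (space trig_borel) = 1"
    by (simp flip: ennreal_mult')
qed

section \<open>Reduction modulo 2\<pi> and invariance of the measure\<close>

definition fold_circle :: "real \<Rightarrow> real" where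
  "fold_circle y = (y + pi) rmod (2 * pi) - pi"

text \<open>With either variable fixed, subtraction takes the form u \<mapsto>
  \<open>fold_circle (c * u + d)\<close> with c = 1 or c = -1, so one invariance statement serves
  both axioms.\<close>

lemma trig_minus_eq_fold: "trig_minus x t = fold_circle (x - t)"
  by (simp add: trig_minus_def fold_circle_def)

lemma fold_circle_range: "- pi \<le> fold_circle y" "fold_circle y < pi"
  using rmod_nonneg[of "2 * pi" "y + pi"] rmod_less[of "2 * pi" "y + pi"]
  by (auto simp: fold_circle_def)

lemma fold_circle_eq:
  assumes "- pi \<le> y + 2 * pi * of_int k" "y + 2 * pi * of_int k < pi"
  shows "fold_circle y = y + 2 * pi * of_int k"
proof -
  have "(y + pi) rmod (2 * pi) = y + pi + 2 * pi * of_int k"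
    by (rule rmod_unique[where n = "- k"]) (use assms in \<open>auto simp: algebra_simps\<close>)
  then show ?thesis by (simp add: fold_circle_def)
qed

lemma borel_measurable_fold_circle [measurable]: "fold_circle \<in> borel_measurable borel"
  unfolding fold_circle_def rmod_def by measurable

text \<open>Substitute s = c u + d. The factor |c| is 1, and by symmetry of the interval u lies in
  it exactly when s - d does.\<close>

lemma nn_integral_fold_piece:
  fixes h :: "real \<Rightarrow> ennreal"
  assumes [measurable]: "h \<in> borel_measurable borel" and c: "\<bar>c\<bar> = 1"
  shows "(\<integral>\<^sup>+u. indicator {-pi..pi} u * (indicator {-pi..<pi} (c * u + d) * h (c * u + d)) \<partial>lborel) =
    (\<integral>\<^sup>+s. indicator {-pi..pi} (s - d) * (indicator {-pi..<pi} s * h s) \<partial>lborel)"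
proof -
  have cc: "c = 1 \<or> c = -1" using c by auto
  have "(\<integral>\<^sup>+s. indicator {-pi..pi} (s - d) * (indicator {-pi..<pi} s * h s) \<partial>lborel) =
      \<bar>c\<bar> * (\<integral>\<^sup>+u. indicator {-pi..pi} (d + c * u - d) * (indicator {-pi..<pi} (d + c * u) * h (d + c * u)) \<partial>lborel)"
    using cc by (intro nn_integral_real_affine) auto
  also have "\<dots> = (\<integral>\<^sup>+u. indicator {-pi..pi} u * (indicator {-pi..<pi} (c * u + d) * h (c * u + d)) \<partial>lborel)"
    using cc by (auto simp: indicator_def add.commute intro!: nn_integral_cong)
  finally show ?thesis ..
qed

text \<open>
  On \<open>[-2\<pi>, 2\<pi>]\<close> reduction modulo \<open>2\<pi>\<close> is one of the three shifts by \<open>-2\<pi>\<close>, \<open>0\<close>, \<open>2\<pi>\<close>; the three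
  shifted copies of the interval tile it up to two points.
\<close>

lemma nn_integral_fold_circle:
  fixes h :: "real \<Rightarrow> ennreal"
  assumes [measurable]: "h \<in> borel_measurable borel" and c: "\<bar>c\<bar> = 1" and d: "\<bar>d\<bar> \<le> pi"
  shows "(\<integral>\<^sup>+u. indicator {-pi..pi} u * h (fold_circle (c * u + d)) \<partial>lborel) =
    (\<integral>\<^sup>+s. indicator {-pi..pi} s * h s \<partial>lborel)"
proof -
  let ?S = "indicator {-pi..pi} :: real \<Rightarrow> ennreal" and ?T = "indicator {-pi..<pi} :: real \<Rightarrow> ennreal"
  have cc: "c = 1 \<or> c = -1" using c by auto
  have pos: "0 < pi" by simp
  \<comment> \<open>For u in the interval, |c u + d| \<le> 2\<pi>, so exactly one of the three
    shifts lands in [-\<pi>, \<pi>) and the other summands vanish.\<close>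
  have split: "?S u * h (fold_circle (c * u + d)) =
      ?S u * (?T (c * u + (d - 2 * pi)) * h (c * u + (d - 2 * pi)))
    + ?S u * (?T (c * u + d) * h (c * u + d))
    + ?S u * (?T (c * u + (d + 2 * pi)) * h (c * u + (d + 2 * pi)))" for u
  proof (cases "u \<in> {-pi..pi}")
    case True
    define y where "y = c * u + d"
    have y: "- 2 * pi \<le> y" "y \<le> 2 * pi"
      using True cc d by (auto simp: y_def)
    have shift: "c * u + d = y" "c * u + (d - 2 * pi) = y - 2 * pi" "c * u + (d + 2 * pi) = y + 2 * pi"
      by (simp_all add: y_def)
    consider "y < - pi" | "- pi \<le> y" "y < pi" | "pi \<le> y" by linarith
    then have "h (fold_circle y) = ?T (y - 2 * pi) * h (y - 2 * pi) + ?T y * h y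
        + ?T (y + 2 * pi) * h (y + 2 * pi)"
    proof cases
      case 1
      then show ?thesis using y fold_circle_eq[of y 1] by (simp add: indicator_def)
    next
      case 2
      then show ?thesis using y fold_circle_eq[of y 0] by (simp add: indicator_def)
    next
      case 3
      moreover from y pos have "y < 3 * pi" by linarith
      ultimately show ?thesis using fold_circle_eq[of y "-1"] by (simp add: indicator_def)
    qed
    then show ?thesis
      unfolding shift using True by simp
  qed simp
  have "(\<integral>\<^sup>+u. ?S u * h (fold_circle (c * u + d)) \<partial>lborel) =
      (\<integral>\<^sup>+s. ?S (s - (d - 2 * pi)) * (?T s * h s) \<partial>lborel) +
      (\<integral>\<^sup>+s. ?S (s - d) * (?T s * h s) \<partial>lborel) +
      (\<integral>\<^sup>+s. ?S (s - (d + 2 * pi)) * (?T s * h s) \<partial>lborel)"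
    unfolding split nn_integral_fold_piece[OF assms(1) c, symmetric]
    by (simp add: nn_integral_add)
  also have "\<dots> = (\<integral>\<^sup>+s. (?S (s - (d - 2 * pi)) + ?S (s - d) + ?S (s - (d + 2 * pi))) * (?T s * h s) \<partial>lborel)"
    by (simp add: nn_integral_add distrib_right)
  also have "\<dots> = (\<integral>\<^sup>+s. ?S s * h s \<partial>lborel)"
  proof (rule nn_integral_cong_AE)
    \<comment> \<open>Adjacent copies overlap at d - \<pi> and d + \<pi>, and the half-open interval
      misses s = \<pi>.\<close>
    have "AE s in lborel. s \<noteq> d - pi \<and> s \<noteq> d + pi \<and> s \<noteq> pi"
      using AE_lborel_singleton[of "d - pi"] AE_lborel_singleton[of "d + pi"] AE_lborel_singleton[of pi]
      by eventually_elim auto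
    then show "AE s in lborel. (?S (s - (d - 2 * pi)) + ?S (s - d) + ?S (s - (d + 2 * pi))) * (?T s * h s) = ?S s * h s"
    proof eventually_elim
      case (elim s)
      show ?case
      proof (cases "s \<in> {-pi..<pi}")
        case True
        have "?S (s - (d - 2 * pi)) + ?S (s - d) + ?S (s - (d + 2 * pi)) = 1"
          using True elim d pos by (auto simp: indicator_def)
        with True show ?thesis by simp
      next
        case False
        with elim show ?thesis by (auto simp: indicator_def)
      qed
    qed
  qed
  finally show ?thesis .
qed

text \<open>This is \<open>nn_integral_fold_circle\<close> for the indicator of a Borel set
  A.\<close>

lemma distr_fold_circle:
  assumes c: "\<bar>c\<bar> = 1" and d: "\<bar>d\<bar> \<le> pi"
  shows "distr trig_borel trig_borel (\<lambda>u. fold_circle (c * u + d)) = trig_borel"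
proof (rule measure_eqI)
  have f: "(\<lambda>u. fold_circle (c * u + d)) \<in> trig_borel \<rightarrow>\<^sub>M trig_borel"
    using fold_circle_range(1) less_imp_le[OF fold_circle_range(2)]
    by (auto simp: measurable_cong_sets[OF sets_trig_borel sets_trig_borel] space_restrict_space
        intro!: measurable_restrict_space2 measurable_restrict_space1)
  fix A assume "A \<in> sets (distr trig_borel trig_borel (\<lambda>u. fold_circle (c * u + d)))"
  then have A: "A \<in> sets trig_borel" by simp
  then have [measurable]: "A \<in> sets borel" and AS: "A \<subseteq> {-pi..pi}"
    by (auto simp: sets_trig_borel_iff)
  let ?B = "(\<lambda>u. fold_circle (c * u + d)) -` A \<inter> {-pi..pi}"
  have B: "?B \<in> sets trig_borel"
    using measurable_sets[OF f A] by simp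
  have "emeasure lborel ?B = (\<integral>\<^sup>+u. indicator ?B u \<partial>lborel)"
    using B by (simp add: sets_trig_borel_iff)
  also have "\<dots> = (\<integral>\<^sup>+u. indicator {-pi..pi} u * indicator A (fold_circle (c * u + d)) \<partial>lborel)"
    by (intro nn_integral_cong) (auto simp: indicator_def)
  also have "\<dots> = (\<integral>\<^sup>+s. indicator {-pi..pi} s * indicator A s \<partial>lborel)"
    by (rule nn_integral_fold_circle[OF _ c d]) measurable
  also have "\<dots> = (\<integral>\<^sup>+s. indicator A s \<partial>lborel)"
    using AS by (intro nn_integral_cong) (auto simp: indicator_def)
  finally show "emeasure (distr trig_borel trig_borel (\<lambda>u. fold_circle (c * u + d))) A = emeasure trig_borel A"
    using A B by (simp add: emeasure_distr[OF f] emeasure_trig_borel)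
qed simp

section \<open>The interval as a translation space\<close>

lemma measure_trig_borel_interval:
  assumes "u \<le> v"
  shows "measure trig_borel ({-pi..pi} \<inter> {u..v}) \<le> (v - u) / (2 * pi)"
proof -
  have "emeasure trig_borel ({-pi..pi} \<inter> {u..v}) =
      ennreal (1 / (2 * pi)) * emeasure lborel ({-pi..pi} \<inter> {u..v})"
    by (rule emeasure_trig_borel) (auto simp: sets_trig_borel_iff)
  also have "\<dots> \<le> ennreal (1 / (2 * pi)) * emeasure lborel {u..v}"
    by (intro mult_left_mono emeasure_mono) auto
  also have "\<dots> = ennreal ((v - u) / (2 * pi))"
    using assms by (simp flip: ennreal_mult')
  finally show ?thesis
    unfolding measure_def using assms by (intro enn2real_leI) auto
qed

text \<open>For |t| \<le> \<delta> a point can enter or leave [-\<pi>, a] only if it lies within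
  \<delta> of a, or within \<delta> of an endpoint, where x - t may wrap around. The measure of
  these points is at most 2\<delta> / \<pi>.\<close>

lemma translation_space_trig:
  "translation_space trig_borel trig_minus trig_nbh ((\<inter>) {-pi..pi} ` range atMost)"
proof -
  interpret prob_space trig_borel by (rule prob_space_trig_borel)
  show ?thesis
  proof unfold_locales
    have "(\<lambda>z. fold_circle (fst z - snd z)) \<in> trig_borel \<Otimes>\<^sub>M trig_borel \<rightarrow>\<^sub>M restrict_space borel {-pi..pi}"
    proof (rule measurable_restrict_space2)
      have id: "(\<lambda>x. x) \<in> borel_measurable trig_borel"
        unfolding measurable_cong_sets[OF sets_trig_borel refl]
        by (intro measurable_restrict_space1) simp
      show "(\<lambda>z. fold_circle (fst z - snd z)) \<in> borel_measurable (trig_borel \<Otimes>\<^sub>M trig_borel)"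
        using measurable_compose[OF measurable_fst id] measurable_compose[OF measurable_snd id] by measurable
    qed (use fold_circle_range(1) less_imp_le[OF fold_circle_range(2)] in auto)
    then show "(\<lambda>(x, t). trig_minus x t) \<in> trig_borel \<Otimes>\<^sub>M trig_borel \<rightarrow>\<^sub>M trig_borel"
      by (simp add: trig_minus_eq_fold case_prod_beta' measurable_cong_sets[OF refl sets_trig_borel])
    show "distr trig_borel trig_borel (\<lambda>t. trig_minus x t) = trig_borel" if "x \<in> space trig_borel" for x
      using distr_fold_circle[of "-1" x] that by (simp add: trig_minus_eq_fold abs_le_iff)
    show "distr trig_borel trig_borel (\<lambda>x. trig_minus x t) = trig_borel" if "t \<in> space trig_borel" for t
      using distr_fold_circle[of 1 "- t"] that by (simp add: trig_minus_eq_fold abs_le_iff)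
    show "trig_nbh N \<in> sets trig_borel" for N
    proof -
      \<comment> \<open>This keeps I_N inside [-\<pi>, \<pi>] for every N, including 0.\<close>
      have "1 / 2 ^ N \<le> (1 :: real)" by (simp add: divide_simps)
      then have "1 / 2 ^ N \<le> pi" using pi_ge_two by linarith
      then show ?thesis by (auto simp: trig_nbh_def sets_trig_borel_iff)
    qed
    show "antimono trig_nbh"
    proof (rule antimonoI)
      fix N N' :: nat assume "N \<le> N'"
      then have "1 / 2 ^ N' \<le> (1 / 2 ^ N :: real)"
        by (intro divide_left_mono power_increasing) auto
      then show "trig_nbh N' \<subseteq> trig_nbh N" by (auto simp: trig_nbh_def)
    qed
    \<comment> \<open>Half-lines generate the Borel sets of the line, so their traces generate the
      trace sigma-algebra.\<close>
    have borel: "sets (borel :: real measure) = sigma_sets UNIV (range atMost)"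
      by (simp add: borel_eq_atMost)
    have "{-pi..pi} \<in> sigma_sets UNIV (range atMost)"
      unfolding borel[symmetric] by simp
    from sigma_sets_Int[OF this subset_UNIV]
    show "sets trig_borel = sigma_sets (space trig_borel) ((\<inter>) {-pi..pi} ` range atMost)"
      unfolding sets_trig_borel sets_restrict_space space_trig_borel borel .
    show "Int_stable ((\<inter>) {-pi..pi} ` range atMost)"
      unfolding image_image
    proof (rule Int_stableI_image)
      fix a b :: real
      show "\<exists>c\<in>UNIV. {-pi..pi} \<inter> {..a} \<inter> ({-pi..pi} \<inter> {..b}) = {-pi..pi} \<inter> {..c}"
        by (intro bexI[of _ "min a b"]) auto
    qed
    show "(\<inter>) {-pi..pi} ` range atMost \<subseteq> Pow (space trig_borel)"
      by auto
    show "\<exists>N\<ge>1. \<forall>t\<in>trig_nbh N. prob {x \<in> space trig_borel. (trig_minus x t \<in> A) \<noteq> (x \<in> A)} < e"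
      if A_gen: "A \<in> (\<inter>) {-pi..pi} ` range atMost" and e: "0 < e" for A :: "real set" and e
    proof -
      obtain a where A: "A = {-pi..pi} \<inter> {..a}"
        using A_gen by blast
      \<comment> \<open>The radius \<delta> of I_N for N = n + 1 is below (1/2)^n, so this bound
        yields 2\<delta> / \<pi> < e; the successor keeps the index positive.\<close>
      obtain n where n: "(1 / 2) ^ n < e * pi / 2"
        using real_arch_pow_inv[of "e * pi / 2" "1 / 2"] e by auto
      define \<delta> :: real where "\<delta> = 1 / 2 ^ Suc n"
      have \<delta>: "0 < \<delta>" "2 * \<delta> / pi < e"
      proof -
        have "\<delta> \<le> (1 / 2) ^ n" by (simp add: \<delta>_def power_one_over field_simps)
        with n have "2 * \<delta> < e * pi" by linarith
        then show "2 * \<delta> / pi < e" by (simp add: pos_divide_less_eq)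
      qed (simp add: \<delta>_def)
      let ?I = "\<lambda>u v. {-pi..pi} \<inter> {u..v}"
      \<comment> \<open>The first two intervals contain the points that may wrap around, the third
        those that may cross a. Their lengths are at most \<delta>, \<delta> and 2\<delta>.\<close>
      let ?C = "?I (-pi) (-pi + \<delta>) \<union> ?I (pi - \<delta>) pi \<union> ?I (a - \<delta>) (a + \<delta>)"
      have I: "?I u v \<in> events" for u v
        by (auto simp: sets_trig_borel_iff)
      have "prob {x \<in> space trig_borel. (trig_minus x t \<in> A) \<noteq> (x \<in> A)} < e"
        if t: "t \<in> trig_nbh (Suc n)" for t
      proof -
        have t': "\<bar>t\<bar> \<le> \<delta>" using t by (auto simp: trig_nbh_def \<delta>_def)
        have "{x \<in> space trig_borel. (trig_minus x t \<in> A) \<noteq> (x \<in> A)} \<subseteq> ?C"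
        proof (rule subsetI, rule ccontr)
          fix x assume "x \<in> {x \<in> space trig_borel. (trig_minus x t \<in> A) \<noteq> (x \<in> A)}" and "x \<notin> ?C"
          then have x: "-pi + \<delta> < x" "x < pi - \<delta>" "\<delta> < \<bar>x - a\<bar>"
            and moved: "(trig_minus x t \<in> A) \<noteq> (x \<in> A)"
            by (auto simp: abs_if)
          have "trig_minus x t = x - t"
            using fold_circle_eq[of "x - t" 0] x t' by (simp add: trig_minus_eq_fold abs_le_iff)
          then show False
            using moved x t' by (auto simp: A abs_if split: if_splits)
        qed
        then have "prob {x \<in> space trig_borel. (trig_minus x t \<in> A) \<noteq> (x \<in> A)} \<le> prob ?C"
          by (intro finite_measure_mono sets.Un I)
        also have "\<dots> \<le> prob (?I (-pi) (-pi + \<delta>)) + prob (?I (pi - \<delta>) pi) + prob (?I (a - \<delta>) (a + \<delta>))"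
          by (intro order_trans[OF measure_Un_le] add_right_mono measure_Un_le sets.Un I order_refl)
        also have "\<dots> \<le> \<delta> / (2 * pi) + \<delta> / (2 * pi) + 2 * \<delta> / (2 * pi)"
          using measure_trig_borel_interval[of "-pi" "-pi + \<delta>"] measure_trig_borel_interval[of "pi - \<delta>" pi]
            measure_trig_borel_interval[of "a - \<delta>" "a + \<delta>"] \<delta>(1) by (intro add_mono) auto
        also have "\<dots> = 2 * \<delta> / pi" by (simp add: field_simps)
        finally show ?thesis using \<delta>(2) by simp
      qed
      then show ?thesis by (intro exI[of _ "Suc n"]) auto
    qed
  qed
qed

theorem theorem1:
  fixes p :: real
  assumes "1 \<le> p"
  shows
    "(\<forall>(m :: nat \<Rightarrow> int) (f :: (nat \<Rightarrow> int) \<Rightarrow> complex) (\<Phi> :: nat \<Rightarrow> (nat \<Rightarrow> int) \<Rightarrow> complex).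
        bdd_above (range m) \<longrightarrow> (\<forall>k. 2 \<le> m k) \<longrightarrow>
        f \<in> Lp_space (vilenkin_measure m) p \<longrightarrow>
        approximate_identity (vilenkin_measure m) (vilenkin_nbh m) \<Phi> \<longrightarrow>
        (\<forall>n\<ge>1. (\<lambda>x. convol (vilenkin_measure m) (vilenkin_minus m) (\<Phi> n) f x - f x)
                 \<in> Lp_space (vilenkin_measure m) p) \<and>
        (\<lambda>n. Lp_norm (vilenkin_measure m) p
               (\<lambda>x. convol (vilenkin_measure m) (vilenkin_minus m) (\<Phi> n) f x - f x))
          \<longlonglongrightarrow> 0)
     \<and>
     (\<forall>(f :: real \<Rightarrow> complex) (\<Phi> :: nat \<Rightarrow> real \<Rightarrow> complex).
        f \<in> Lp_space trig_measure p \<longrightarrow>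
        approximate_identity trig_measure trig_nbh \<Phi> \<longrightarrow>
        (\<forall>n\<ge>1. (\<lambda>x. convol trig_measure trig_minus (\<Phi> n) f x - f x)
                 \<in> Lp_space trig_measure p) \<and>
        (\<lambda>n. Lp_norm trig_measure p (\<lambda>x. convol trig_measure trig_minus (\<Phi> n) f x - f x))
          \<longlonglongrightarrow> 0)"
proof (intro conjI allI impI)
  fix m :: "nat \<Rightarrow> int" and f :: "(nat \<Rightarrow> int) \<Rightarrow> complex" and \<Phi> :: "nat \<Rightarrow> (nat \<Rightarrow> int) \<Rightarrow> complex"
  assume m: "\<forall>k. 2 \<le> m k" and f: "f \<in> Lp_space (vilenkin_measure m) p"
    and \<Phi>: "approximate_identity (vilenkin_measure m) (vilenkin_nbh m) \<Phi>"
  note A = translation_space.approximate_identity_Lp[OF translation_space_vilenkin assms f \<Phi>, OF m[rule_format]]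
  show "(\<lambda>x. convol (vilenkin_measure m) (vilenkin_minus m) (\<Phi> n) f x - f x) \<in> Lp_space (vilenkin_measure m) p"
    if "1 \<le> n" for n
    using that by (rule A(1))
  show "(\<lambda>n. Lp_norm (vilenkin_measure m) p
      (\<lambda>x. convol (vilenkin_measure m) (vilenkin_minus m) (\<Phi> n) f x - f x)) \<longlonglongrightarrow> 0"
    by (rule A(2))
next
  fix f :: "real \<Rightarrow> complex" and \<Phi> :: "nat \<Rightarrow> real \<Rightarrow> complex"
  assume f: "f \<in> Lp_space trig_measure p" and \<Phi>: "approximate_identity trig_measure trig_nbh \<Phi>"
  \<comment> \<open>The Lebesgue setting is reached by reading \<open>trig_measure\<close> as the
    completion of \<open>trig_borel\<close>.\<close>
  note A = translation_space.approximate_identity_Lp_completion[OF translation_space_trig assms,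
      folded trig_measure_eq_completion, OF f \<Phi>]
  show "(\<lambda>x. convol trig_measure trig_minus (\<Phi> n) f x - f x) \<in> Lp_space trig_measure p" if "1 \<le> n" for n
    using that by (rule A(1))
  show "(\<lambda>n. Lp_norm trig_measure p (\<lambda>x. convol trig_measure trig_minus (\<Phi> n) f x - f x)) \<longlonglongrightarrow> 0"
    by (rule A(2))
qed

end
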